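(* Let $G$ be a group with the Hall property. Then $\mathbb{Q}G$ is both right Noetherian and left Noetherian; hence $G$ is amenable, and every subgroup of $G$ is finitely generated.
   Context: Groups are discrete. A group $G$ has the Hall property if, for every finitely generated $\mathbb{Z}G$-module $M$, there is a finite set of primes $\pi$ such that the underlying additive group of $M$ is an extension of a free abelian group by a $\pi$-torsion group; that is, $M$ has a free abelian additive subgroup $F$ (not necessarily a $\mathbb{Z}G$-submodule, possibly of infinite rank) such that every element of $M/F$ has finite order whose prime divisors all belong to $\pi$. *)

theory Defs
  imports
    "HOL-Algebra.Free_Abelian_Groups"
    "HOL-Algebra.AbelCoset"
    "HOL-Algebra.Module"
    "HOL-Algebra.Generated_Groups"
    "HOL-Algebra.Multiplicative_Group"
    "HOL-Computational_Algebra.Primes"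
begin

section \<open>Group rings\<close>

text \<open>
  Elements of the group ring \<open>R[G]\<close> are finitely supported functions on \<open>carrier G\<close>; the
  coefficient ring \<open>R\<close> is given by the type \<open>'c\<close>. For integer coefficients the additive group is
  \<^term>\<open>free_Abelian_group (carrier G)\<close>.
\<close>

definition group_ring :: "('a, 'b) monoid_scheme \<Rightarrow> ('a \<Rightarrow>\<^sub>0 'c::comm_ring_1) ring" where
  "group_ring G =
    \<lparr>carrier = {f. Poly_Mapping.keys f \<subseteq> carrier G},
     monoid.mult = (\<lambda>f g. \<Sum>x\<in>Poly_Mapping.keys f. \<Sum>y\<in>Poly_Mapping.keys g.
        Poly_Mapping.single (x \<otimes>\<^bsub>G\<^esub> y) (Poly_Mapping.lookup f x * Poly_Mapping.lookup g y)),
     one = Poly_Mapping.single \<one>\<^bsub>G\<^esub> 1,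
     zero = 0,
     add = (+)\<rparr>"


section \<open>One-sided modules and Noetherianity\<close>

text \<open>
  The locale \<^locale>\<open>module\<close> of the library requires a commutative ring of scalars; the locale
  below has the same axioms over an arbitrary ring. The library predicate \<^const>\<open>submodule\<close> does
  not require commutativity.
\<close>

locale left_module = R?: ring R + M?: abelian_group M
  for R :: "('r, 'b) ring_scheme" (structure) and M :: "('r, 'm, 'c) module_scheme" (structure) +
  assumes smult_closed [simp, intro]:
      "\<lbrakk>a \<in> carrier R; x \<in> carrier M\<rbrakk> \<Longrightarrow> a \<odot>\<^bsub>M\<^esub> x \<in> carrier M"
    and smult_l_distr:
      "\<lbrakk>a \<in> carrier R; b \<in> carrier R; x \<in> carrier M\<rbrakk> \<Longrightarrow>
        (a \<oplus> b) \<odot>\<^bsub>M\<^esub> x = a \<odot>\<^bsub>M\<^esub> x \<oplus>\<^bsub>M\<^esub> b \<odot>\<^bsub>M\<^esub> x"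
    and smult_r_distr:
      "\<lbrakk>a \<in> carrier R; x \<in> carrier M; y \<in> carrier M\<rbrakk> \<Longrightarrow>
        a \<odot>\<^bsub>M\<^esub> (x \<oplus>\<^bsub>M\<^esub> y) = a \<odot>\<^bsub>M\<^esub> x \<oplus>\<^bsub>M\<^esub> a \<odot>\<^bsub>M\<^esub> y"
    and smult_assoc:
      "\<lbrakk>a \<in> carrier R; b \<in> carrier R; x \<in> carrier M\<rbrakk> \<Longrightarrow>
        (a \<otimes> b) \<odot>\<^bsub>M\<^esub> x = a \<odot>\<^bsub>M\<^esub> (b \<odot>\<^bsub>M\<^esub> x)"
    and smult_one [simp]: "x \<in> carrier M \<Longrightarrow> \<one> \<odot>\<^bsub>M\<^esub> x = x"

definition finitely_generated_module ::
    "('r, 'b) ring_scheme \<Rightarrow> ('r, 'm, 'c) module_scheme \<Rightarrow> bool" where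
  "finitely_generated_module R M \<longleftrightarrow>
    (\<exists>S. finite S \<and> S \<subseteq> carrier M \<and> (\<forall>N. submodule N R M \<and> S \<subseteq> N \<longrightarrow> N = carrier M))"

definition left_ideal :: "'r set \<Rightarrow> ('r, 'b) ring_scheme \<Rightarrow> bool" where
  "left_ideal I R \<longleftrightarrow>
    additive_subgroup I R \<and> (\<forall>x\<in>carrier R. \<forall>a\<in>I. x \<otimes>\<^bsub>R\<^esub> a \<in> I)"

definition right_ideal :: "'r set \<Rightarrow> ('r, 'b) ring_scheme \<Rightarrow> bool" where
  "right_ideal I R \<longleftrightarrow>
    additive_subgroup I R \<and> (\<forall>x\<in>carrier R. \<forall>a\<in>I. a \<otimes>\<^bsub>R\<^esub> x \<in> I)"

definition left_noetherian :: "('r, 'b) ring_scheme \<Rightarrow> bool" where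
  "left_noetherian R \<longleftrightarrow> ring R \<and>
    (\<forall>I. left_ideal I R \<longrightarrow>
      (\<exists>S. finite S \<and> S \<subseteq> I \<and> (\<forall>J. left_ideal J R \<and> S \<subseteq> J \<longrightarrow> I \<subseteq> J)))"

definition right_noetherian :: "('r, 'b) ring_scheme \<Rightarrow> bool" where
  "right_noetherian R \<longleftrightarrow> ring R \<and>
    (\<forall>I. right_ideal I R \<longrightarrow>
      (\<exists>S. finite S \<and> S \<subseteq> I \<and> (\<forall>J. right_ideal J R \<and> S \<subseteq> J \<longrightarrow> I \<subseteq> J)))"


section \<open>The Hall property\<close>

text \<open>
  A basis of a free abelian group \<open>A\<close> is a subset of \<open>A\<close>, so index sets \<open>S\<close> of the element type
  of \<open>A\<close> suffice.
\<close>

definition free_abelian :: "('a, 'b) monoid_scheme \<Rightarrow> bool" where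
  "free_abelian A \<longleftrightarrow> (\<exists>S::'a set. A \<cong> free_Abelian_group S)"

text \<open>
  \<^term>\<open>group.ord\<close> is \<open>0\<close> on elements of infinite order. The constant \<open>prime\<close> of
  \<open>HOL-Algebra\<close> hides the one on numbers, whence the qualified name.
\<close>

definition torsion_group :: "nat set \<Rightarrow> ('a, 'b) monoid_scheme \<Rightarrow> bool" where
  "torsion_group \<pi> A \<longleftrightarrow>
    (\<forall>x\<in>carrier A. group.ord A x \<noteq> 0 \<and>
      (\<forall>p. Factorial_Ring.prime p \<and> p dvd group.ord A x \<longrightarrow> p \<in> \<pi>))"

definition free_by_torsion :: "nat set \<Rightarrow> ('a, 'b) monoid_scheme \<Rightarrow> bool" where
  "free_by_torsion \<pi> A \<longleftrightarrow>
    (\<exists>F. subgroup F A \<and> free_abelian (A\<lparr>carrier := F\<rparr>) \<and> torsion_group \<pi> (A Mod F))"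

text \<open>
  HOL cannot quantify over the element type of \<open>M\<close>. An element of a finitely generated
  \<open>\<int>G\<close>-module is determined by a list of coefficients with respect to a fixed list of
  generators, so every such module is isomorphic to one whose elements are lists over \<open>\<int>G\<close>.
  Lemma \<open>hall_property_module\<close> below shows that nothing is lost.

  Modules are left modules; \<open>x g = g\<^sup>-\<^sup>1 x\<close> converts them to right modules with the same
  additive group and the same submodules.
\<close>

definition hall_property :: "('a, 'b) monoid_scheme \<Rightarrow> bool" where
  "hall_property G \<longleftrightarrow>
    (\<forall>M :: ('a \<Rightarrow>\<^sub>0 int, ('a \<Rightarrow>\<^sub>0 int) list) module.
      left_module (group_ring G) M \<and> finitely_generated_module (group_ring G) M \<longrightarrow>
      (\<exists>\<pi>. finite \<pi> \<and> (\<forall>p\<in>\<pi>. Factorial_Ring.prime p) \<and> free_by_torsion \<pi> (add_monoid M)))"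


section \<open>Amenability\<close>

definition amenable :: "('a, 'b) monoid_scheme \<Rightarrow> bool" where
  "amenable G \<longleftrightarrow>
    (\<exists>\<mu> :: 'a set \<Rightarrow> real.
      \<mu> (carrier G) = 1 \<and>
      (\<forall>A. A \<subseteq> carrier G \<longrightarrow> 0 \<le> \<mu> A) \<and>
      (\<forall>A B. A \<subseteq> carrier G \<and> B \<subseteq> carrier G \<and> A \<inter> B = {} \<longrightarrow> \<mu> (A \<union> B) = \<mu> A + \<mu> B) \<and>
      (\<forall>g\<in>carrier G. \<forall>A. A \<subseteq> carrier G \<longrightarrow> \<mu> (g <#\<^bsub>G\<^esub> A) = \<mu> A))"


section \<open>Adequacy of the definitions\<close>

lemma group_ring_mult_superset:
  assumes "finite A" "Poly_Mapping.keys f \<subseteq> A" "finite B" "Poly_Mapping.keys g \<subseteq> B"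
  shows "f \<otimes>\<^bsub>group_ring G\<^esub> g = (\<Sum>x\<in>A. \<Sum>y\<in>B.
    Poly_Mapping.single (x \<otimes>\<^bsub>G\<^esub> y) (Poly_Mapping.lookup f x * Poly_Mapping.lookup g y))"
proof -
  have "(\<Sum>x\<in>A. \<Sum>y\<in>B. Poly_Mapping.single (x \<otimes>\<^bsub>G\<^esub> y) (Poly_Mapping.lookup f x * Poly_Mapping.lookup g y))
     = (\<Sum>x\<in>A. \<Sum>y\<in>Poly_Mapping.keys g. Poly_Mapping.single (x \<otimes>\<^bsub>G\<^esub> y) (Poly_Mapping.lookup f x * Poly_Mapping.lookup g y))"
    by (intro sum.cong refl sum.mono_neutral_right assms)
      (auto simp: in_keys_iff)
  also have "\<dots> = (\<Sum>x\<in>Poly_Mapping.keys f. \<Sum>y\<in>Poly_Mapping.keys g. Poly_Mapping.single (x \<otimes>\<^bsub>G\<^esub> y) (Poly_Mapping.lookup f x * Poly_Mapping.lookup g y))"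
    by (intro sum.mono_neutral_right assms) (auto simp: in_keys_iff)
  finally show ?thesis by (simp add: group_ring_def)
qed

lemma group_ring_l_distr:
  "(f + g) \<otimes>\<^bsub>group_ring G\<^esub> h = f \<otimes>\<^bsub>group_ring G\<^esub> h + g \<otimes>\<^bsub>group_ring G\<^esub> h"
proof -
  let ?A = "Poly_Mapping.keys f \<union> Poly_Mapping.keys g" and ?B = "Poly_Mapping.keys h"
  have "Poly_Mapping.keys (f + g) \<subseteq> ?A" by (rule keys_add)
  then show ?thesis
    by (simp add: group_ring_mult_superset[where A="?A" and B="?B"] lookup_add distrib_right
        single_add sum.distrib)
qed

lemma group_ring_r_distr:
  "h \<otimes>\<^bsub>group_ring G\<^esub> (f + g) = h \<otimes>\<^bsub>group_ring G\<^esub> f + h \<otimes>\<^bsub>group_ring G\<^esub> g"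
proof -
  let ?B = "Poly_Mapping.keys f \<union> Poly_Mapping.keys g" and ?A = "Poly_Mapping.keys h"
  have "Poly_Mapping.keys (f + g) \<subseteq> ?B" by (rule keys_add)
  then show ?thesis
    by (simp add: group_ring_mult_superset[where A="?A" and B="?B"] lookup_add distrib_left
        single_add sum.distrib)
qed

lemma group_ring_mult_zero [simp]:
  "0 \<otimes>\<^bsub>group_ring G\<^esub> h = 0" "h \<otimes>\<^bsub>group_ring G\<^esub> 0 = 0"
  by (simp_all add: group_ring_def)

lemma group_ring_sum_l: "(\<Sum>i\<in>I. f i) \<otimes>\<^bsub>group_ring G\<^esub> h = (\<Sum>i\<in>I. f i \<otimes>\<^bsub>group_ring G\<^esub> h)"
  by (induction I rule: infinite_finite_induct) (simp_all add: group_ring_l_distr)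

lemma group_ring_sum_r: "h \<otimes>\<^bsub>group_ring G\<^esub> (\<Sum>i\<in>I. f i) = (\<Sum>i\<in>I. h \<otimes>\<^bsub>group_ring G\<^esub> f i)"
  by (induction I rule: infinite_finite_induct) (simp_all add: group_ring_r_distr)

lemma group_ring_single:
  "Poly_Mapping.single x a \<otimes>\<^bsub>group_ring G\<^esub> Poly_Mapping.single y b = Poly_Mapping.single (x \<otimes>\<^bsub>G\<^esub> y) (a * b)"
  by (subst group_ring_mult_superset[where A="{x}" and B="{y}"]) auto

lemma sum_single_keys:
  "f = (\<Sum>x\<in>Poly_Mapping.keys f. Poly_Mapping.single x (Poly_Mapping.lookup f x))"
  by (rule poly_mapping_eqI)
    (auto simp: lookup_sum lookup_single when_def sum.delta' in_keys_iff)

lemma group_ring_mult_eq: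
  "f \<otimes>\<^bsub>group_ring G\<^esub> g = (\<Sum>x\<in>Poly_Mapping.keys f. \<Sum>y\<in>Poly_Mapping.keys g.
    Poly_Mapping.single (x \<otimes>\<^bsub>G\<^esub> y) (Poly_Mapping.lookup f x * Poly_Mapping.lookup g y))"
  by (simp add: group_ring_def)

lemma ring_group_ring:
  fixes G :: "('a, 'b) monoid_scheme"
  assumes "group G"
  shows "ring (group_ring G :: ('a \<Rightarrow>\<^sub>0 'c::comm_ring_1) ring)"
proof -
  interpret group G by fact
  let ?R = "group_ring G :: ('a \<Rightarrow>\<^sub>0 'c) ring"
  have sel: "carrier ?R = {f. Poly_Mapping.keys f \<subseteq> carrier G}" "zero ?R = 0"
    "add ?R = (+)" "one ?R = Poly_Mapping.single \<one>\<^bsub>G\<^esub> 1"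
    by (simp_all add: group_ring_def)
  have assoc: "f \<otimes>\<^bsub>?R\<^esub> g \<otimes>\<^bsub>?R\<^esub> h = f \<otimes>\<^bsub>?R\<^esub> (g \<otimes>\<^bsub>?R\<^esub> h)"
    if "f \<in> carrier ?R" "g \<in> carrier ?R" "h \<in> carrier ?R" for f g h
  proof -
    have fG: "Poly_Mapping.keys f \<subseteq> carrier G" and gG: "Poly_Mapping.keys g \<subseteq> carrier G"
      and hG: "Poly_Mapping.keys h \<subseteq> carrier G"
      using that by (auto simp: sel)
    let ?s = Poly_Mapping.single and ?l = Poly_Mapping.lookup and ?k = Poly_Mapping.keys
    have "f \<otimes>\<^bsub>?R\<^esub> g \<otimes>\<^bsub>?R\<^esub> h
        = (\<Sum>x\<in>?k f. \<Sum>y\<in>?k g. ?s (x \<otimes>\<^bsub>G\<^esub> y) (?l f x * ?l g y))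
            \<otimes>\<^bsub>?R\<^esub> (\<Sum>z\<in>?k h. ?s z (?l h z))"
      by (subst group_ring_mult_eq[where f=f and g=g]) (simp add: sum_single_keys[symmetric])
    also have "\<dots> = (\<Sum>x\<in>?k f. \<Sum>y\<in>?k g. \<Sum>z\<in>?k h.
        ?s ((x \<otimes>\<^bsub>G\<^esub> y) \<otimes>\<^bsub>G\<^esub> z) ((?l f x * ?l g y) * ?l h z))"
      by (simp only: group_ring_sum_l) (simp only: group_ring_sum_r group_ring_single)
    also have "\<dots> = (\<Sum>x\<in>?k f. \<Sum>y\<in>?k g. \<Sum>z\<in>?k h.
        ?s (x \<otimes>\<^bsub>G\<^esub> (y \<otimes>\<^bsub>G\<^esub> z)) (?l f x * (?l g y * ?l h z)))"
      using fG gG hG by (intro sum.cong refl) (auto simp: m_assoc mult.assoc subset_iff)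
    also have "\<dots> = (\<Sum>x\<in>?k f. ?s x (?l f x))
        \<otimes>\<^bsub>?R\<^esub> (\<Sum>y\<in>?k g. \<Sum>z\<in>?k h. ?s (y \<otimes>\<^bsub>G\<^esub> z) (?l g y * ?l h z))"
      by (simp only: group_ring_sum_l) (simp only: group_ring_sum_r group_ring_single)
    also have "\<dots> = f \<otimes>\<^bsub>?R\<^esub> (g \<otimes>\<^bsub>?R\<^esub> h)"
      by (subst group_ring_mult_eq[where f=g and g=h]) (simp add: sum_single_keys[symmetric])
    finally show ?thesis .
  qed
  have closed: "f \<otimes>\<^bsub>?R\<^esub> g \<in> carrier ?R" if "f \<in> carrier ?R" "g \<in> carrier ?R" for f g
  proof -
    have "Poly_Mapping.keys (f \<otimes>\<^bsub>?R\<^esub> g) \<subseteq> carrier G"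
      unfolding group_ring_mult_eq using that
      by (intro order_trans[OF keys_sum] UN_least) (auto simp: sel subset_iff split: if_splits)
    then show ?thesis by (simp add: sel)
  qed
  have one_l: "\<one>\<^bsub>?R\<^esub> \<otimes>\<^bsub>?R\<^esub> f = f" if "f \<in> carrier ?R" for f
  proof -
    have "\<one>\<^bsub>?R\<^esub> \<otimes>\<^bsub>?R\<^esub> f = (\<Sum>y\<in>Poly_Mapping.keys f. Poly_Mapping.single (\<one>\<^bsub>G\<^esub> \<otimes>\<^bsub>G\<^esub> y) (Poly_Mapping.lookup f y))"
      unfolding sel by (subst group_ring_mult_superset[where A="{\<one>\<^bsub>G\<^esub>}" and B="Poly_Mapping.keys f"]) auto
    also have "\<dots> = (\<Sum>y\<in>Poly_Mapping.keys f. Poly_Mapping.single y (Poly_Mapping.lookup f y))"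
      using that by (intro sum.cong refl) (auto simp: sel subset_iff)
    also have "\<dots> = f" by (rule sum_single_keys[symmetric])
    finally show ?thesis .
  qed
  have one_r: "f \<otimes>\<^bsub>?R\<^esub> \<one>\<^bsub>?R\<^esub> = f" if "f \<in> carrier ?R" for f
  proof -
    have "f \<otimes>\<^bsub>?R\<^esub> \<one>\<^bsub>?R\<^esub> = (\<Sum>y\<in>Poly_Mapping.keys f. Poly_Mapping.single (y \<otimes>\<^bsub>G\<^esub> \<one>\<^bsub>G\<^esub>) (Poly_Mapping.lookup f y))"
      unfolding sel by (subst group_ring_mult_superset[where B="{\<one>\<^bsub>G\<^esub>}" and A="Poly_Mapping.keys f"]) auto
    also have "\<dots> = (\<Sum>y\<in>Poly_Mapping.keys f. Poly_Mapping.single y (Poly_Mapping.lookup f y))"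
      using that by (intro sum.cong refl) (auto simp: sel subset_iff)
    also have "\<dots> = f" by (rule sum_single_keys[symmetric])
    finally show ?thesis .
  qed
  show ?thesis
  proof (rule ringI)
    show "abelian_group ?R"
    proof (rule abelian_groupI)
      fix f assume "f \<in> carrier ?R"
      then show "\<exists>g\<in>carrier ?R. g \<oplus>\<^bsub>?R\<^esub> f = \<zero>\<^bsub>?R\<^esub>"
        by (intro bexI[of _ "- f"]) (auto simp: sel)
    qed (use keys_add in \<open>fastforce simp: sel ac_simps\<close>)+
    show "monoid ?R"
      by (rule monoidI) (use assoc closed one_l one_r in \<open>auto simp: sel\<close>)
  qed (simp_all add: sel group_ring_l_distr group_ring_r_distr)
qed

lemma ord_iso_eq:
  assumes "group A" "group B" "\<And>n::nat. x [^]\<^bsub>A\<^esub> n = \<one>\<^bsub>A\<^esub> \<longleftrightarrow> y [^]\<^bsub>B\<^esub> n = \<one>\<^bsub>B\<^esub>"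
  shows "group.ord A x = group.ord B y"
  unfolding group.ord_def[OF assms(1)] group.ord_def[OF assms(2)] using assms(3) by simp

lemma free_by_torsion_iso:
  fixes A :: "('a, 'c) monoid_scheme" and B :: "('b, 'd) monoid_scheme"
  assumes A: "comm_group A" and B: "comm_group B" and h: "h \<in> Group.iso A B"
    and "free_by_torsion \<pi> A"
  shows "free_by_torsion \<pi> B"
proof -
  interpret A: comm_group A by fact
  interpret B: comm_group B by fact
  interpret h: group_hom A B h
    using h by unfold_locales (simp add: iso_def)
  have inj: "inj_on h (carrier A)" and surj: "h ` carrier A = carrier B"
    using h by (auto simp: iso_iff)
  obtain F and S :: "'a set" where F: "subgroup F A"
    and S: "A\<lparr>carrier := F\<rparr> \<cong> free_Abelian_group S" and tors: "torsion_group \<pi> (A Mod F)"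
    using assms(4) by (auto simp: free_by_torsion_def free_abelian_def)
  have FA: "F \<subseteq> carrier A" using F by (rule subgroup.subset)
  have F': "subgroup (h ` F) B" using F by (rule h.subgroup_img_is_subgroup)
  interpret N: normal F A using F by (simp add: A.normal_iff_subgroup)
  interpret N': normal "h ` F" B using F' by (simp add: B.normal_iff_subgroup)
  have hF: "h \<in> Group.iso (A\<lparr>carrier := F\<rparr>) (B\<lparr>carrier := h ` F\<rparr>)"
    using FA inj by (auto simp: iso_iff hom_def inj_on_def subset_iff)
  have grF: "group (A\<lparr>carrier := F\<rparr>)" using F by (rule A.subgroup_imp_group)
  have grF': "group (B\<lparr>carrier := h ` F\<rparr>)" using F' by (rule B.subgroup_imp_group)
  have iso: "B\<lparr>carrier := h ` F\<rparr> \<cong> free_Abelian_group S"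
    using iso_trans[OF group.iso_sym[OF grF is_isoI[OF hF]] S] .
  obtain k where k: "k \<in> Group.iso (free_Abelian_group S) (B\<lparr>carrier := h ` F\<rparr>)"
    using group.iso_sym[OF grF' iso] by (auto simp: is_iso_def)
  have "inj_on k (carrier (free_Abelian_group S))" using k by (simp add: iso_iff)
  then have "inj_on (k \<circ> frag_of) S"
    unfolding inj_on_def comp_def by (metis frag_of_eq frag_of_in_free_Abelian_group)
  then have "S \<approx> (k \<circ> frag_of) ` S"
    by (auto simp: eqpoll_def bij_betw_def)
  then have "free_Abelian_group S \<cong> free_Abelian_group ((k \<circ> frag_of) ` S)"
    by (simp add: isomorphic_free_Abelian_groups)
  from iso_trans[OF iso this] have "free_abelian (B\<lparr>carrier := h ` F\<rparr>)"
    unfolding free_abelian_def by (rule exI)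
  moreover have "torsion_group \<pi> (B Mod h ` F)"
    unfolding torsion_group_def
  proof (intro ballI)
    fix X assume "X \<in> carrier (B Mod h ` F)"
    then obtain b where b: "b \<in> carrier B" "X = h ` F #>\<^bsub>B\<^esub> b"
      unfolding carrier_FactGroup by blast
    then obtain a where a: "a \<in> carrier A" and X: "X = h ` F #>\<^bsub>B\<^esub> h a"
      unfolding surj[symmetric] by blast
    have mem: "F #>\<^bsub>A\<^esub> x = F \<longleftrightarrow> h ` F #>\<^bsub>B\<^esub> h x = h ` F" if x: "x \<in> carrier A" for x
    proof -
      have "F #>\<^bsub>A\<^esub> x = F \<longleftrightarrow> x \<in> F"
        using A.coset_join1[OF _ x F] A.coset_join2[OF x F] by blast
      also have "\<dots> \<longleftrightarrow> h x \<in> h ` F"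
        using inj_on_image_mem_iff[OF inj x FA] by simp
      also have "\<dots> \<longleftrightarrow> h ` F #>\<^bsub>B\<^esub> h x = h ` F"
        using B.coset_join1[OF _ h.hom_closed[OF x] F'] B.coset_join2[OF h.hom_closed[OF x] F']
        by blast
      finally show ?thesis .
    qed
    have "group.ord (A Mod F) (F #>\<^bsub>A\<^esub> a) = group.ord (B Mod h ` F) X"
      by (rule ord_iso_eq[OF N.factorgroup_is_group N'.factorgroup_is_group])
        (use a mem in \<open>simp add: X N.FactGroup_pow N'.FactGroup_pow flip: h.hom_nat_pow\<close>)
    moreover have "F #>\<^bsub>A\<^esub> a \<in> carrier (A Mod F)"
      using a by (simp add: carrier_FactGroup)
    ultimately show "group.ord (B Mod h ` F) X \<noteq> 0 \<and>
      (\<forall>p. Factorial_Ring.prime p \<and> p dvd group.ord (B Mod h ` F) X \<longrightarrow> p \<in> \<pi>)"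
      using tors by (auto simp: torsion_group_def)
  qed
  ultimately show ?thesis
    using F' by (auto simp: free_by_torsion_def)
qed

lemma (in left_module) smult_l_null: "x \<in> carrier M \<Longrightarrow> \<zero> \<odot>\<^bsub>M\<^esub> x = \<zero>\<^bsub>M\<^esub>"
  using smult_l_distr[of \<zero> \<zero> x]
  by (metis M.add.r_cancel_one' R.l_zero R.zero_closed smult_closed)

lemma (in left_module) smult_l_minus_one:
  assumes "x \<in> carrier M"
  shows "(\<ominus> \<one>) \<odot>\<^bsub>M\<^esub> x = \<ominus>\<^bsub>M\<^esub> x"
proof -
  have "(\<ominus> \<one>) \<odot>\<^bsub>M\<^esub> x \<oplus>\<^bsub>M\<^esub> x = (\<ominus> \<one> \<oplus> \<one>) \<odot>\<^bsub>M\<^esub> x"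
    using assms by (simp add: smult_l_distr)
  then show ?thesis
    using assms by (metis M.minus_equality R.add.inv_closed R.l_neg R.one_closed smult_closed smult_l_null)
qed

lemma (in left_module) submoduleI:
  assumes "H \<subseteq> carrier M" "\<zero>\<^bsub>M\<^esub> \<in> H"
    and add: "\<And>a b. \<lbrakk>a \<in> H; b \<in> H\<rbrakk> \<Longrightarrow> a \<oplus>\<^bsub>M\<^esub> b \<in> H"
    and smult: "\<And>a x. \<lbrakk>a \<in> carrier R; x \<in> H\<rbrakk> \<Longrightarrow> a \<odot>\<^bsub>M\<^esub> x \<in> H"
  shows "submodule H R M"
proof -
  have "\<ominus>\<^bsub>M\<^esub> x \<in> H" if "x \<in> H" for x
    using smult[of "\<ominus> \<one>" x] that assms(1) by (auto simp: smult_l_minus_one subset_iff)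
  then show ?thesis
    by (intro submodule.intro subgroup.intro submodule_axioms.intro)
      (use assms in \<open>simp_all flip: a_inv_def\<close>)
qed

primrec lincomb :: "('r, 'm, 'c) module_scheme \<Rightarrow> 'm list \<Rightarrow> 'r list \<Rightarrow> 'm" where
  "lincomb M [] rs = \<zero>\<^bsub>M\<^esub>"
| "lincomb M (s # ss) rs = hd rs \<odot>\<^bsub>M\<^esub> s \<oplus>\<^bsub>M\<^esub> lincomb M ss (tl rs)"

context left_module
begin

definition coeffs :: "nat \<Rightarrow> 'r list set" where
  "coeffs n = {rs. length rs = n \<and> set rs \<subseteq> carrier R}"

lemma coeffs_Suc: "rs \<in> coeffs (Suc n) \<longleftrightarrow> (\<exists>r qs. rs = r # qs \<and> r \<in> carrier R \<and> qs \<in> coeffs n)"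
  by (cases rs) (auto simp: coeffs_def)

lemma lincomb_closed:
  "\<lbrakk>set ss \<subseteq> carrier M; rs \<in> coeffs (length ss)\<rbrakk> \<Longrightarrow> lincomb M ss rs \<in> carrier M"
  by (induction ss arbitrary: rs) (auto simp: coeffs_Suc)

lemma lincomb_zero:
  "set ss \<subseteq> carrier M \<Longrightarrow> \<zero>\<^bsub>M\<^esub> \<in> lincomb M ss ` coeffs (length ss)"
proof (induction ss)
  case (Cons s ss)
  then obtain rs where "rs \<in> coeffs (length ss)" "lincomb M ss rs = \<zero>\<^bsub>M\<^esub>" by force
  then show ?case
    using Cons.prems by (intro image_eqI[of _ _ "\<zero> # rs"]) (auto simp: coeffs_Suc smult_l_null)
qed (auto simp: coeffs_def)

lemma lincomb_add:
  "\<lbrakk>set ss \<subseteq> carrier M; x \<in> lincomb M ss ` coeffs (length ss); y \<in> lincomb M ss ` coeffs (length ss)\<rbrakk>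
    \<Longrightarrow> x \<oplus>\<^bsub>M\<^esub> y \<in> lincomb M ss ` coeffs (length ss)"
proof (induction ss arbitrary: x y)
  case (Cons s ss)
  from Cons.prems obtain r q rs qs where
    *: "r \<in> carrier R" "q \<in> carrier R" "rs \<in> coeffs (length ss)" "qs \<in> coeffs (length ss)"
    "x = r \<odot>\<^bsub>M\<^esub> s \<oplus>\<^bsub>M\<^esub> lincomb M ss rs" "y = q \<odot>\<^bsub>M\<^esub> s \<oplus>\<^bsub>M\<^esub> lincomb M ss qs"
    by (auto simp: coeffs_Suc)
  have "lincomb M ss rs \<oplus>\<^bsub>M\<^esub> lincomb M ss qs \<in> lincomb M ss ` coeffs (length ss)"
    using Cons * by auto
  then obtain ps where ps: "ps \<in> coeffs (length ss)"
    "lincomb M ss rs \<oplus>\<^bsub>M\<^esub> lincomb M ss qs = lincomb M ss ps" by auto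
  have "x \<oplus>\<^bsub>M\<^esub> y = (r \<oplus> q) \<odot>\<^bsub>M\<^esub> s \<oplus>\<^bsub>M\<^esub> lincomb M ss ps"
    using * Cons.prems lincomb_closed[of ss rs] lincomb_closed[of ss qs]
    by (simp add: smult_l_distr M.a_ac flip: ps(2))
  then show ?case
    using * ps by (intro image_eqI[of _ _ "(r \<oplus> q) # ps"]) (auto simp: coeffs_Suc)
qed (auto simp: coeffs_def)

lemma lincomb_smult:
  "\<lbrakk>set ss \<subseteq> carrier M; x \<in> lincomb M ss ` coeffs (length ss); a \<in> carrier R\<rbrakk>
    \<Longrightarrow> a \<odot>\<^bsub>M\<^esub> x \<in> lincomb M ss ` coeffs (length ss)"
proof (induction ss arbitrary: x)
  case Nil
  have "a \<odot>\<^bsub>M\<^esub> \<zero>\<^bsub>M\<^esub> = \<zero>\<^bsub>M\<^esub>"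
    using smult_r_distr[of a "\<zero>\<^bsub>M\<^esub>" "\<zero>\<^bsub>M\<^esub>"] Nil.prems
    by (metis M.add.r_cancel_one' M.l_zero M.zero_closed smult_closed)
  with Nil show ?case by (auto simp: coeffs_def)
next
  case (Cons s ss)
  from Cons.prems obtain r rs where
    *: "r \<in> carrier R" "rs \<in> coeffs (length ss)" "x = r \<odot>\<^bsub>M\<^esub> s \<oplus>\<^bsub>M\<^esub> lincomb M ss rs"
    by (auto simp: coeffs_Suc)
  have "a \<odot>\<^bsub>M\<^esub> lincomb M ss rs \<in> lincomb M ss ` coeffs (length ss)"
    using Cons * by auto
  then obtain ps where ps: "ps \<in> coeffs (length ss)"
    "a \<odot>\<^bsub>M\<^esub> lincomb M ss rs = lincomb M ss ps" by auto
  have "a \<odot>\<^bsub>M\<^esub> x = (a \<otimes> r) \<odot>\<^bsub>M\<^esub> s \<oplus>\<^bsub>M\<^esub> lincomb M ss ps"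
    using * Cons.prems lincomb_closed[of ss rs]
    by (simp add: smult_r_distr smult_assoc flip: ps(2))
  then show ?case
    using * ps Cons.prems by (intro image_eqI[of _ _ "(a \<otimes> r) # ps"]) (auto simp: coeffs_Suc)
qed

lemma lincomb_incl:
  "\<lbrakk>set ss \<subseteq> carrier M; s \<in> set ss\<rbrakk> \<Longrightarrow> s \<in> lincomb M ss ` coeffs (length ss)"
proof (induction ss)
  case (Cons t ss)
  show ?case
  proof (cases "s = t")
    case True
    from lincomb_zero[of ss] Cons.prems obtain rs where
      "rs \<in> coeffs (length ss)" "lincomb M ss rs = \<zero>\<^bsub>M\<^esub>" by force
    then show ?thesis
      using Cons.prems True by (intro image_eqI[of _ _ "\<one> # rs"]) (auto simp: coeffs_Suc)
  next
    case False
    then obtain rs where "rs \<in> coeffs (length ss)" "s = lincomb M ss rs"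
      using Cons by auto
    then show ?thesis
      using Cons.prems lincomb_closed[of ss rs]
      by (intro image_eqI[of _ _ "\<zero> # rs"]) (auto simp: coeffs_Suc smult_l_null)
  qed
qed simp

lemma finitely_generated_imp_lincomb:
  assumes "finitely_generated_module R M"
  obtains ss where "set ss \<subseteq> carrier M" "carrier M = lincomb M ss ` coeffs (length ss)"
proof -
  obtain S where S: "finite S" "S \<subseteq> carrier M"
    and gen: "\<And>N. \<lbrakk>submodule N R M; S \<subseteq> N\<rbrakk> \<Longrightarrow> N = carrier M"
    using assms by (auto simp: finitely_generated_module_def)
  obtain ss where ss: "set ss = S" using S(1) finite_list by blast
  have "submodule (lincomb M ss ` coeffs (length ss)) R M"
    by (rule submoduleI)
      (use S ss lincomb_closed lincomb_zero lincomb_add lincomb_smult in \<open>auto simp del: image_iff\<close>)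
  then have "lincomb M ss ` coeffs (length ss) = carrier M"
    by (rule gen) (use S ss lincomb_incl in auto)
  with that ss S(2) show ?thesis by metis
qed

lemma transport:
  fixes e :: "'m \<Rightarrow> 'n"
  assumes e: "inj_on e (carrier M)"
  obtains M' :: "('r, 'n) module" where "left_module R M'"
    "finitely_generated_module R M \<Longrightarrow> finitely_generated_module R M'"
    "e \<in> Group.iso (add_monoid M) (add_monoid M')"
proof -
  define d where "d = inv_into (carrier M) e"
  have d [simp]: "d (e x) = x" if "x \<in> carrier M" for x
    unfolding d_def using e that by (rule inv_into_f_f)
  define M' :: "('r, 'n) module" where
    "M' = \<lparr>carrier = e ` carrier M, monoid.mult = undefined, one = undefined, zero = e \<zero>\<^bsub>M\<^esub>,
           add = (\<lambda>x y. e (d x \<oplus>\<^bsub>M\<^esub> d y)), smult = (\<lambda>a x. e (a \<odot>\<^bsub>M\<^esub> d x))\<rparr>"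
  have sel: "carrier M' = e ` carrier M" "\<zero>\<^bsub>M'\<^esub> = e \<zero>\<^bsub>M\<^esub>"
    "x \<oplus>\<^bsub>M'\<^esub> y = e (d x \<oplus>\<^bsub>M\<^esub> d y)" "a \<odot>\<^bsub>M'\<^esub> x = e (a \<odot>\<^bsub>M\<^esub> d x)" for x y a
    by (simp_all add: M'_def)
  have "abelian_group M'"
  proof (rule abelian_groupI)
    fix x assume "x \<in> carrier M'"
    then obtain u where "u \<in> carrier M" "x = e u" by (auto simp: sel)
    then show "\<exists>y\<in>carrier M'. y \<oplus>\<^bsub>M'\<^esub> x = \<zero>\<^bsub>M'\<^esub>"
      by (intro bexI[of _ "e (\<ominus>\<^bsub>M\<^esub> u)"]) (auto simp: sel M.l_neg)
  qed (auto simp: sel M.a_ac)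
  then have M': "left_module R M'"
    by (intro left_module.intro left_module_axioms.intro R.ring_axioms)
      (auto simp: sel smult_l_distr smult_r_distr smult_assoc)
  interpret M': left_module R M' by (rule M')
  have iso: "e \<in> Group.iso (add_monoid M) (add_monoid M')"
    using e by (auto simp: iso_iff hom_def sel)
  have "finitely_generated_module R M'" if fg: "finitely_generated_module R M"
  proof -
    obtain S where S: "finite S" "S \<subseteq> carrier M"
      and gen: "\<And>N. \<lbrakk>submodule N R M; S \<subseteq> N\<rbrakk> \<Longrightarrow> N = carrier M"
      using fg by (auto simp: finitely_generated_module_def)
    show ?thesis unfolding finitely_generated_module_def
    proof (intro exI[of _ "e ` S"] conjI allI impI)
      fix N assume N: "submodule N R M' \<and> e ` S \<subseteq> N"
      then interpret N: submodule N R M' by simp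
      have NM: "N \<subseteq> e ` carrier M" using N.subset by (simp add: sel)
      have zero: "e \<zero>\<^bsub>M\<^esub> \<in> N"
        using N.one_closed by (simp add: sel)
      have add: "e (x \<oplus>\<^bsub>M\<^esub> y) \<in> N"
        if "x \<in> carrier M" "y \<in> carrier M" "e x \<in> N" "e y \<in> N" for x y
        using N.m_closed[OF that(3,4)] that by (simp add: sel)
      have smult: "e (a \<odot>\<^bsub>M\<^esub> x) \<in> N" if "a \<in> carrier R" "x \<in> carrier M" "e x \<in> N" for a x
        using N.smult_closed[OF that(1,3)] that by (simp add: sel)
      have "submodule {x \<in> carrier M. e x \<in> N} R M"
        by (intro submoduleI) (use zero add smult in auto)
      then have "{x \<in> carrier M. e x \<in> N} = carrier M"
        by (rule gen) (use N S in auto)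
      then show "N = carrier M'"
        using NM by (auto simp: sel)
    qed (use S in \<open>auto simp: sel\<close>)
  qed
  with M' iso that show ?thesis by blast
qed

end

text \<open>The Hall property applies to finitely generated modules over all types.\<close>

theorem hall_property_module:
  fixes G :: "('a, 'b) monoid_scheme" and M :: "('a \<Rightarrow>\<^sub>0 int, 'm, 'c) module_scheme"
  assumes hall: "hall_property G" and M: "left_module (group_ring G) M"
    and fg: "finitely_generated_module (group_ring G) M"
  shows "\<exists>\<pi>. finite \<pi> \<and> (\<forall>p\<in>\<pi>. Factorial_Ring.prime p) \<and> free_by_torsion \<pi> (add_monoid M)"
proof -
  interpret M: left_module "group_ring G" M by fact
  obtain ss where ss: "carrier M = lincomb M ss ` M.coeffs (length ss)"
    using M.finitely_generated_imp_lincomb[OF fg] by metis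
  define e where "e = inv_into (M.coeffs (length ss)) (lincomb M ss)"
  have "inj_on e (carrier M)"
    unfolding e_def ss by (rule inj_on_inv_into) simp
  then obtain M' :: "('a \<Rightarrow>\<^sub>0 int, ('a \<Rightarrow>\<^sub>0 int) list) module" where M': "left_module (group_ring G) M'"
    "finitely_generated_module (group_ring G) M'" and e: "e \<in> Group.iso (add_monoid M) (add_monoid M')"
    using M.transport[of e] fg by metis
  interpret M': left_module "group_ring G" M' by fact
  obtain \<pi> where \<pi>: "finite \<pi>" "\<forall>p\<in>\<pi>. Factorial_Ring.prime p" "free_by_torsion \<pi> (add_monoid M')"
    using hall M' unfolding hall_property_def by blast
  have "inv_into (carrier (add_monoid M)) e \<in> Group.iso (add_monoid M') (add_monoid M)"
    using group.iso_set_sym[OF M.M.a_group e] .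
  then have "free_by_torsion \<pi> (add_monoid M)"
    using free_by_torsion_iso M.M.a_comm_group M'.M.a_comm_group \<pi>(3) by blast
  with \<pi> show ?thesis by blast
qed

end

theory Submission
  imports Defs "HOL-Analysis.Function_Topology" "HOL-Computational_Algebra.Polynomial"
begin

text \<open>
  All three conclusions come from one property of permutation modules. Let \<open>\<Omega>\<close> be a \<open>G\<close>-set with finitely
  many orbits. Among any elements \<open>x\<^sub>0, x\<^sub>1, \<dots>\<close> of \<open>\<int>\<Omega>\<close> some \<open>x\<^sub>i\<close> has a nonzero integer multiple in the
  submodule generated by \<open>x\<^sub>j\<close> with \<open>j < i\<close> (\<open>eventually_torsion_over_span\<close>).

  Suppose that this fails, and let \<open>K\<^sub>i\<close> be the pure closure of the submodule generated by \<open>x\<^sub>j\<close>, \<open>j < i\<close>.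
  The quotient \<open>\<int>\<Omega> / K\<^sub>i\<close> is finitely generated and torsion-free, and \<open>x\<^sub>i\<close> is nonzero in it. By the Hall
  property it is nearly free, so only finitely many primes divide \<open>x\<^sub>i\<close> there. This leaves room for distinct primes
  \<open>p\<^sub>0, p\<^sub>1, \<dots>\<close> such that \<open>x\<^sub>i\<close> does not lie in \<open>K\<^sub>i + p\<^sub>i \<int>\<Omega>\<close>. Let \<open>L\<close> be the submodule generated by
  all \<open>p\<^sub>0 \<cdots> p\<^sub>j x\<^sub>j\<close>. It lies in \<open>K\<^sub>i + p\<^sub>i \<int>\<Omega>\<close> for every \<open>i\<close>, so \<open>p\<^sub>0 \<cdots> p\<^bsub>i-1\<^esub> x\<^sub>i\<close> has order
  exactly \<open>p\<^sub>i\<close> modulo \<open>L\<close>. So \<open>\<int>\<Omega> / L\<close> has torsion for infinitely many primes, against the Hall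
  property.

  Left and right ideals of \<open>\<rat>G\<close> are, after clearing denominators, submodules of \<open>\<int>G\<close> for \<open>G\<close> acting on
  itself by left multiplication and by \<open>h \<mapsto> h g\<inverse>\<close>. Hence both Noetherian properties. If a subgroup were not
  finitely generated, it would contain \<open>h\<^sub>0, h\<^sub>1, \<dots>\<close> with no \<open>h\<^sub>i\<close> in the subgroup generated by its
  predecessors, and the elements \<open>h\<^sub>i - 1\<close> would contradict the same property.

  For amenability take \<open>\<Omega> = G \<times> {0, \<dots>, m - 1}\<close>, so that \<open>\<int>\<Omega>\<close> is free of rank \<open>m\<close>. The property excludes
  injective equivariant maps from rank \<open>m + 1\<close> to rank \<open>m\<close> (\<open>strong_rank_condition\<close>). When \<open>G\<close> is not amenable,
  an idea of Bartholdi produces such a map. Choose sets \<open>Y\<^sub>s \<subseteq> {0, \<dots>, m - 1}\<close>,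
  one for each \<open>s\<close> in a finite set \<open>S\<close>, such that among any \<open>d\<close> of them each keeps \<open>m / d\<close> private points, up to a
  factor logarithmic in \<open>\<bar>S\<bar>\<close> (\<open>isolating_family\<close>). Without amenability, \<open>S\<close> can be chosen so that \<open>\<bar>F S\<bar> / \<bar>F\<bar>\<close>
  exceeds this factor for every finite nonempty \<open>F\<close>, because passing to powers of \<open>S\<close> makes the ratio grow
  exponentially and the factor only linearly (\<open>expanding_power\<close>). Read an element of the free module of
  rank \<open>m + 1\<close> as a family of polynomials of degree at most \<open>m\<close> indexed by \<open>G\<close>, and let the coordinate of its image
  at \<open>(h, i)\<close> be the sum, over the \<open>s\<close> with \<open>i \<in> Y\<^sub>s\<close>, of the polynomial at \<open>h s\<inverse>\<close> evaluated at an integer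
  \<open>t\<^bsub>s,i\<^esub>\<close>; these integers are distinct. Let \<open>F\<close> be the support of a nonzero element of the kernel. Counting private
  points over \<open>F S\<close> gives a \<open>g \<in> F\<close> with more than \<open>m\<close> of them. At each one the value of the polynomial at
  \<open>g\<close> is the only summand, so that polynomial has more than \<open>m\<close> roots and vanishes, which it does not
  (\<open>expanding_imp_injective\<close>).
\<close>

section \<open>Abelian groups that are free by torsion\<close>

text \<open>
  An isomorphism turns powers into integer multiples, and \<open>n\<close> can be cancelled coefficientwise.
\<close>

lemma torsion_free_free_abelian:
  assumes F: "group A" and iso: "\<phi> \<in> Group.iso A (free_Abelian_group S)"
    and x: "x \<in> carrier A" "x [^]\<^bsub>A\<^esub> (n::nat) = \<one>\<^bsub>A\<^esub>" "n \<noteq> 0"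
  shows "x = \<one>\<^bsub>A\<^esub>"
proof -
  interpret h: group_hom A "free_Abelian_group S" \<phi>
    using F iso by (simp add: group_hom_def group_hom_axioms_def iso_def)
  have "frag_cmul (int n) (\<phi> x) = 0"
    using h.hom_nat_pow[OF x(1), of n] x(2) by simp
  then have "\<phi> x = \<phi> \<one>\<^bsub>A\<^esub>"
    using x(3) by simp
  then show ?thesis
    using iso x(1) by (auto simp: iso_iff inj_on_def)
qed

lemma (in comm_group) pow_mem_torsion_quotient:
  assumes F: "subgroup F G" and tors: "torsion_group \<pi> (G Mod F)" and x: "x \<in> carrier G"
  obtains n :: nat where "n \<noteq> 0" "x [^] n \<in> F" "\<And>p. Factorial_Ring.prime p \<Longrightarrow> p dvd n \<Longrightarrow> p \<in> \<pi>"
proof -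
  interpret N: normal F G using F by (simp add: normal_iff_subgroup)
  interpret Q: group "G Mod F" by (rule N.factorgroup_is_group)
  let ?n = "group.ord (G Mod F) (F #> x)"
  have mem: "F #> x \<in> carrier (G Mod F)" using x by (simp add: carrier_FactGroup)
  have "(F #> x) [^]\<^bsub>G Mod F\<^esub> ?n = \<one>\<^bsub>G Mod F\<^esub>"
    using Q.pow_ord_eq_1[OF mem] .
  then have "F #> (x [^] ?n) = F"
    using x by (simp add: N.FactGroup_pow)
  then have "x [^] ?n \<in> F"
    using coset_join1[OF _ _ F] x F by (meson nat_pow_closed subgroup.subset)
  then show thesis
    using that tors mem by (auto simp: torsion_group_def)
qed

text \<open>
  Some power of \<open>x\<close> with exponent \<open>n\<close> composed of primes in \<open>\<pi>\<close> lies in the free part; being torsion there,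
  it is trivial. So \<open>p\<close>, the order of \<open>x\<close>, divides \<open>n\<close>.
\<close>

lemma (in comm_group) free_by_torsion_prime_torsion:
  assumes "free_by_torsion \<pi> G"
    and x: "x \<in> carrier G" "x \<noteq> \<one>" "x [^] p = \<one>" and p: "Factorial_Ring.prime (p::nat)"
  shows "p \<in> \<pi>"
proof -
  obtain F and S :: "'a set" where F: "subgroup F G"
    and S: "G\<lparr>carrier := F\<rparr> \<cong> free_Abelian_group S" and tors: "torsion_group \<pi> (G Mod F)"
    using assms(1) by (auto simp: free_by_torsion_def free_abelian_def)
  obtain \<phi> where \<phi>: "\<phi> \<in> Group.iso (G\<lparr>carrier := F\<rparr>) (free_Abelian_group S)"
    using S by (auto simp: is_iso_def)
  obtain n where n: "n \<noteq> 0" "x [^] n \<in> F" and \<pi>: "\<And>p. Factorial_Ring.prime p \<Longrightarrow> p dvd n \<Longrightarrow> p \<in> \<pi>"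
    by (rule pow_mem_torsion_quotient[OF F tors x(1)]) (rule that)
  have "(x [^] n) [^] p = \<one>"
    using x by (metis nat_pow_one nat_pow_pow mult.commute)
  then have "x [^] n = \<one>"
    using torsion_free_free_abelian[OF subgroup_imp_group[OF F] \<phi>, of "x [^] n" p] n p
    by (simp add: nat_pow_def not_prime_0 prime_gt_0_nat)
  then have "ord x dvd n" "ord x dvd p"
    using x by (auto simp: pow_eq_id)
  moreover have "ord x \<noteq> 1" using x pow_ord_eq_1[of x] nat_pow_eone[of x] by metis
  ultimately have "p dvd n"
    using p by (metis prime_nat_iff)
  with \<pi> p show ?thesis by blast
qed

text \<open>
  Move a power of \<open>x\<close> into the free part and pick a nonzero coefficient \<open>c\<close> of it. A prime outside \<open>\<pi>\<close>
  that divides \<open>x\<close> still divides \<open>c\<close>, because a \<open>p\<close>-th root of \<open>x\<close> enters the free part after raising it to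
  a power whose exponent is composed of primes in \<open>\<pi>\<close>.
\<close>

lemma (in comm_group) free_by_torsion_finite_divisors:
  assumes fbt: "free_by_torsion \<pi> G" and \<pi>: "finite \<pi>"
    and tf: "\<And>y n::nat. \<lbrakk>y \<in> carrier G; n \<noteq> 0; y [^] n = \<one>\<rbrakk> \<Longrightarrow> y = \<one>"
    and x: "x \<in> carrier G" "x \<noteq> \<one>"
  shows "finite {p::nat. Factorial_Ring.prime p \<and> (\<exists>y\<in>carrier G. x = y [^] p)}"
proof -
  obtain F and S :: "'a set" where F: "subgroup F G"
    and S: "G\<lparr>carrier := F\<rparr> \<cong> free_Abelian_group S" and tors: "torsion_group \<pi> (G Mod F)"
    using fbt by (auto simp: free_by_torsion_def free_abelian_def)
  obtain \<phi> where \<phi>: "\<phi> \<in> Group.iso (G\<lparr>carrier := F\<rparr>) (free_Abelian_group S)"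
    using S by (auto simp: is_iso_def)
  interpret h: group_hom "G\<lparr>carrier := F\<rparr>" "free_Abelian_group S" \<phi>
    using subgroup_imp_group[OF F] \<phi> by (simp add: group_hom_def group_hom_axioms_def iso_def)
  have \<phi>_pow: "\<phi> (z [^] n) = frag_cmul (int n) (\<phi> z)" if "z \<in> F" for z and n :: nat
    using h.hom_nat_pow[of z n] that by (simp flip: nat_pow_consistent)
  obtain m where m: "m \<noteq> 0" "x [^] m \<in> F" "\<And>p. Factorial_Ring.prime p \<Longrightarrow> p dvd m \<Longrightarrow> p \<in> \<pi>"
    by (rule pow_mem_torsion_quotient[OF F tors x(1)]) (rule that)
  have "x [^] m \<noteq> \<one>" using tf[OF x(1) m(1)] x(2) by blast
  then have "\<phi> (x [^] m) \<noteq> 0"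
    using h.hom_one \<phi> m(2) subgroup.one_closed[OF F] by (auto simp: iso_iff inj_on_def)
  then have "Poly_Mapping.keys (\<phi> (x [^] m)) \<noteq> {}" by simp
  then obtain s where s: "Poly_Mapping.lookup (\<phi> (x [^] m)) s \<noteq> 0"
    by (meson all_not_in_conv in_keys_iff)
  define c where "c = Poly_Mapping.lookup (\<phi> (x [^] m)) s"
  have "p dvd nat \<bar>c\<bar>" if p: "Factorial_Ring.prime p" "p \<notin> \<pi>" and y: "y \<in> carrier G" "x = y [^] p" for p y
  proof -
    obtain k where k: "k \<noteq> 0" "y [^] k \<in> F"
      and k\<pi>: "\<And>p. Factorial_Ring.prime p \<Longrightarrow> p dvd k \<Longrightarrow> p \<in> \<pi>"
      by (rule pow_mem_torsion_quotient[OF F tors y(1)]) (rule that)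
    have "(x [^] m) [^] k = (y [^] k) [^] (p * m)"
      using y by (simp add: nat_pow_pow ac_simps)
    then have "\<phi> ((x [^] m) [^] k) = \<phi> ((y [^] k) [^] (p * m))" by simp
    then have "frag_cmul (int k) (\<phi> (x [^] m)) = frag_cmul (int (p * m)) (\<phi> (y [^] k))"
      by (simp only: \<phi>_pow m(2) k(2))
    then have "int k * c = int (p * m) * Poly_Mapping.lookup (\<phi> (y [^] k)) s"
      unfolding c_def by (metis lookup_frag_cmul)
    then have "int p dvd int k * c" by simp
    moreover have "\<not> p dvd k" using k\<pi> p by blast
    ultimately have "int p dvd c"
      using p(1) by (metis int_dvd_int_iff prime_dvd_mult_iff prime_nat_int_transfer)
    then show ?thesis by (simp add: dvd_nat_abs_iff)
  qed
  then have "{p::nat. Factorial_Ring.prime p \<and> (\<exists>y\<in>carrier G. x = y [^] p)} \<subseteq> \<pi> \<union> {p. p dvd nat \<bar>c\<bar>}"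
    by blast
  moreover have "finite {p. p dvd nat \<bar>c\<bar>}"
    by (rule finite_divisors_nat) (use s in \<open>simp add: c_def\<close>)
  ultimately show ?thesis using \<pi> by (meson finite_UnI finite_subset)
qed

section \<open>Permutation modules and their quotients\<close>

text \<open>
  The permutation module \<open>\<int>\<Omega>\<close> is the library's free abelian group on \<open>\<Omega>\<close>. Keeping the action arbitrary lets one
  argument serve left ideals, right ideals and free modules of any rank.
\<close>

locale G_set = group G for G :: "('a, 'b) monoid_scheme" (structure) +
  fixes act :: "'a \<Rightarrow> 'x \<Rightarrow> 'x" and \<Omega> :: "'x set"
  assumes act_closed: "\<lbrakk>g \<in> carrier G; w \<in> \<Omega>\<rbrakk> \<Longrightarrow> act g w \<in> \<Omega>"
    and act_one: "w \<in> \<Omega> \<Longrightarrow> act \<one> w = w"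
    and act_mult: "\<lbrakk>g \<in> carrier G; h \<in> carrier G; w \<in> \<Omega>\<rbrakk> \<Longrightarrow> act (g \<otimes> h) w = act g (act h w)"
begin

definition translate :: "'a \<Rightarrow> ('x \<Rightarrow>\<^sub>0 int) \<Rightarrow> ('x \<Rightarrow>\<^sub>0 int)" where
  "translate g = frag_extend (frag_of \<circ> act g)"

abbreviation "A \<equiv> free_Abelian_group \<Omega>"
abbreviation "Z \<equiv> {x :: 'x \<Rightarrow>\<^sub>0 int. Poly_Mapping.keys x \<subseteq> \<Omega>}"

lemma translate_simps [simp]:
  "translate g 0 = 0" "translate g (frag_of w) = frag_of (act g w)" "translate g (- x) = - translate g x"
  "translate g (x + y) = translate g x + translate g y" "translate g (x - y) = translate g x - translate g y"
  "translate g (frag_cmul k x) = frag_cmul k (translate g x)"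
  by (simp_all add: translate_def frag_extend_minus frag_extend_add frag_extend_diff frag_extend_cmul)

lemma keys_translate: "\<lbrakk>g \<in> carrier G; Poly_Mapping.keys x \<subseteq> \<Omega>\<rbrakk> \<Longrightarrow> Poly_Mapping.keys (translate g x) \<subseteq> \<Omega>"
  unfolding translate_def using act_closed by (intro order_trans[OF keys_frag_extend]) auto

lemma translate_one: "Poly_Mapping.keys x \<subseteq> \<Omega> \<Longrightarrow> translate \<one> x = x"
  by (induction x rule: frag_induction) (auto simp: act_one)

lemma translate_mult:
  assumes "g \<in> carrier G" "h \<in> carrier G"
  shows "Poly_Mapping.keys x \<subseteq> \<Omega> \<Longrightarrow> translate (g \<otimes> h) x = translate g (translate h x)"
  by (induction x rule: frag_induction) (auto simp: act_mult assms)

definition scalar_mult :: "('a \<Rightarrow>\<^sub>0 int) \<Rightarrow> ('x \<Rightarrow>\<^sub>0 int) \<Rightarrow> ('x \<Rightarrow>\<^sub>0 int)" where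
  "scalar_mult r x = frag_extend (\<lambda>g. translate g x) r"

lemma scalar_mult_simps [simp]:
  "scalar_mult 0 x = 0" "scalar_mult (frag_of g) x = translate g x" "scalar_mult (r - s) x = scalar_mult r x - scalar_mult s x"
  "scalar_mult (r + s) x = scalar_mult r x + scalar_mult s x"
  by (simp_all add: scalar_mult_def frag_extend_add frag_extend_diff)

lemma scalar_mult_add: "scalar_mult r (x + y) = scalar_mult r x + scalar_mult r y"
  by (simp add: scalar_mult_def frag_extend_def frag_cmul_distrib2 sum.distrib)

lemma keys_scalar_mult:
  assumes "Poly_Mapping.keys r \<subseteq> carrier G" "Poly_Mapping.keys x \<subseteq> \<Omega>"
  shows "Poly_Mapping.keys (scalar_mult r x) \<subseteq> \<Omega>"
  unfolding scalar_mult_def using assms keys_translate by (intro order_trans[OF keys_frag_extend]) blast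

lemma translate_scalar_mult:
  assumes g: "g \<in> carrier G" and x: "Poly_Mapping.keys x \<subseteq> \<Omega>"
  shows "Poly_Mapping.keys r \<subseteq> carrier G \<Longrightarrow> translate g (scalar_mult r x) = scalar_mult (frag_of g \<otimes>\<^bsub>group_ring G\<^esub> r) x"
proof (induction r rule: frag_induction)
  case (one h)
  then show ?case using translate_mult[OF g _ x] by (simp add: group_ring_single)
next
  case (diff a b)
  have "frag_of g \<otimes>\<^bsub>group_ring G\<^esub> (a - b) = frag_of g \<otimes>\<^bsub>group_ring G\<^esub> a - frag_of g \<otimes>\<^bsub>group_ring G\<^esub> b"
    using group_ring_r_distr[of G "frag_of g" "a - b" b] by simp
  with diff show ?case by simp
qed simp

lemma scalar_mult_mult:
  assumes x: "Poly_Mapping.keys x \<subseteq> \<Omega>" and s: "Poly_Mapping.keys s \<subseteq> carrier G"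
  shows "Poly_Mapping.keys r \<subseteq> carrier G \<Longrightarrow> scalar_mult (r \<otimes>\<^bsub>group_ring G\<^esub> s) x = scalar_mult r (scalar_mult s x)"
proof (induction r rule: frag_induction)
  case (one h)
  then show ?case using translate_scalar_mult[OF _ x s] by simp
next
  case (diff a b)
  have "(a - b) \<otimes>\<^bsub>group_ring G\<^esub> s = a \<otimes>\<^bsub>group_ring G\<^esub> s - b \<otimes>\<^bsub>group_ring G\<^esub> s"
    using group_ring_l_distr[of G "a - b" b s] by simp
  with diff show ?case by simp
qed simp

definition G_submodule :: "('x \<Rightarrow>\<^sub>0 int) set \<Rightarrow> bool" where
  "G_submodule U \<longleftrightarrow> U \<subseteq> Z \<and> 0 \<in> U \<and> (\<forall>x\<in>U. \<forall>y\<in>U. x - y \<in> U) \<and> (\<forall>g\<in>carrier G. \<forall>x\<in>U. translate g x \<in> U)"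

lemma G_submoduleI:
  assumes "\<And>x. x \<in> U \<Longrightarrow> Poly_Mapping.keys x \<subseteq> \<Omega>" "0 \<in> U" "\<And>x y. \<lbrakk>x \<in> U; y \<in> U\<rbrakk> \<Longrightarrow> x - y \<in> U"
    "\<And>g x. \<lbrakk>g \<in> carrier G; x \<in> U\<rbrakk> \<Longrightarrow> translate g x \<in> U"
  shows "G_submodule U"
  using assms by (auto simp: G_submodule_def)

lemma G_submoduleD:
  assumes "G_submodule U"
  shows "x \<in> U \<Longrightarrow> Poly_Mapping.keys x \<subseteq> \<Omega>" "0 \<in> U" "\<lbrakk>x \<in> U; y \<in> U\<rbrakk> \<Longrightarrow> x - y \<in> U"
    "\<lbrakk>g \<in> carrier G; x \<in> U\<rbrakk> \<Longrightarrow> translate g x \<in> U" "x \<in> U \<Longrightarrow> - x \<in> U" "\<lbrakk>x \<in> U; y \<in> U\<rbrakk> \<Longrightarrow> x + y \<in> U"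
    "x \<in> U \<Longrightarrow> frag_cmul k x \<in> U"
proof -
  note a = assms[unfolded G_submodule_def]
  show "x \<in> U \<Longrightarrow> Poly_Mapping.keys x \<subseteq> \<Omega>" "0 \<in> U" "\<lbrakk>g \<in> carrier G; x \<in> U\<rbrakk> \<Longrightarrow> translate g x \<in> U"
    using a by auto
  show d: "\<lbrakk>x \<in> U; y \<in> U\<rbrakk> \<Longrightarrow> x - y \<in> U" for x y using a by blast
  show m: "x \<in> U \<Longrightarrow> - x \<in> U" for x using a d[of 0 x] by simp
  show "\<lbrakk>x \<in> U; y \<in> U\<rbrakk> \<Longrightarrow> x + y \<in> U" using d[of x "- y"] m by simp
  show "x \<in> U \<Longrightarrow> frag_cmul k x \<in> U"
    by (rule frag_closure_minus_cmul[where P="\<lambda>x. x \<in> U"]) (use a d in auto)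
qed

lemma G_submodule_scalar_mult:
  assumes "G_submodule U" "x \<in> U"
  shows "Poly_Mapping.keys r \<subseteq> carrier G \<Longrightarrow> scalar_mult r x \<in> U"
  by (induction r rule: frag_induction) (use G_submoduleD[OF assms(1)] assms(2) in auto)

lemma G_submodule_subgroup: "G_submodule U \<Longrightarrow> subgroup U A"
  using G_submoduleD[of U] by (intro subgroup.intro) auto

definition G_span :: "('x \<Rightarrow>\<^sub>0 int) set \<Rightarrow> ('x \<Rightarrow>\<^sub>0 int) set" where
  "G_span X = \<Inter>{U. G_submodule U \<and> X \<subseteq> U}"

lemma G_submodule_carrier: "G_submodule Z"
proof (rule G_submoduleI)
  show "x - y \<in> Z" if "x \<in> Z" "y \<in> Z" for x y
    using that keys_diff[of x y] by blast
qed (use keys_translate in auto)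

lemma G_submodule_G_span: "X \<subseteq> Z \<Longrightarrow> G_submodule (G_span X)"
proof (rule G_submoduleI)
  fix x assume "X \<subseteq> Z" "x \<in> G_span X"
  then have "x \<in> Z" using G_submodule_carrier unfolding G_span_def by blast
  then show "Poly_Mapping.keys x \<subseteq> \<Omega>" by simp
next
  show "x - y \<in> G_span X" if "x \<in> G_span X" "y \<in> G_span X" for x y
    using that G_submoduleD(3) unfolding G_span_def by blast
  show "translate g x \<in> G_span X" if "g \<in> carrier G" "x \<in> G_span X" for g x
    using that G_submoduleD(4) unfolding G_span_def by blast
qed (simp add: G_span_def G_submoduleD(2))

lemma G_span_superset: "X \<subseteq> G_span X"
  by (auto simp: G_span_def)

lemma G_span_minimal: "\<lbrakk>G_submodule U; X \<subseteq> U\<rbrakk> \<Longrightarrow> G_span X \<subseteq> U"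
  by (auto simp: G_span_def)

text \<open>
  The additive structure is that of the quotient group, to which the definition of the Hall property refers.
  The scalar multiple of a coset is written as a union over its elements, all of whose terms are equal, which
  avoids choosing a representative.
\<close>

definition quotient_module :: "('x \<Rightarrow>\<^sub>0 int) set \<Rightarrow> ('a \<Rightarrow>\<^sub>0 int, ('x \<Rightarrow>\<^sub>0 int) set) module" where
  "quotient_module U = \<lparr>carrier = carrier (A Mod U), monoid.mult = undefined, one = undefined,
     zero = U, add = (<#>\<^bsub>A\<^esub>), module.smult = (\<lambda>r X. \<Union>x\<in>X. U #>\<^bsub>A\<^esub> scalar_mult r x)\<rparr>"

context
  fixes U assumes U: "G_submodule U"
begin

interpretation A: comm_group A by (rule abelian_free_Abelian_group)
interpretation N: normal U A using G_submodule_subgroup[OF U] by (simp add: A.normal_iff_subgroup)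

lemma coset_zero: "U #>\<^bsub>A\<^esub> 0 = U"
  by (auto simp: r_coset_def)

lemma coset_eq_iff:
  assumes "Poly_Mapping.keys x \<subseteq> \<Omega>" "Poly_Mapping.keys y \<subseteq> \<Omega>"
  shows "U #>\<^bsub>A\<^esub> x = U #>\<^bsub>A\<^esub> y \<longleftrightarrow> x - y \<in> U"
proof -
  have "U #>\<^bsub>A\<^esub> x = U #>\<^bsub>A\<^esub> y \<longleftrightarrow> x \<in> U #>\<^bsub>A\<^esub> y"
    using A.repr_independence[OF _ _ G_submodule_subgroup[OF U], of x y]
      A.rcos_self[OF _ G_submodule_subgroup[OF U], of x] assms by auto
  moreover have "x \<in> U #>\<^bsub>A\<^esub> y \<longleftrightarrow> x - y \<in> U"
    by (auto simp: r_coset_def intro: bexI[of _ "x - y"])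
  ultimately show ?thesis by blast
qed

lemma quotient_module_add:
  "\<lbrakk>Poly_Mapping.keys x \<subseteq> \<Omega>; Poly_Mapping.keys y \<subseteq> \<Omega>\<rbrakk> \<Longrightarrow> (U #>\<^bsub>A\<^esub> x) \<oplus>\<^bsub>quotient_module U\<^esub> (U #>\<^bsub>A\<^esub> y) = U #>\<^bsub>A\<^esub> (x + y)"
  by (simp add: quotient_module_def N.rcos_sum)

lemma quotient_module_smult:
  assumes r: "Poly_Mapping.keys r \<subseteq> carrier G" and x: "Poly_Mapping.keys x \<subseteq> \<Omega>"
  shows "r \<odot>\<^bsub>quotient_module U\<^esub> (U #>\<^bsub>A\<^esub> x) = U #>\<^bsub>A\<^esub> scalar_mult r x"
proof -
  have "U #>\<^bsub>A\<^esub> scalar_mult r y = U #>\<^bsub>A\<^esub> scalar_mult r x" if y: "y \<in> U #>\<^bsub>A\<^esub> x" for y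
  proof -
    obtain u where u: "u \<in> U" "y = u + x" using y by (auto simp: r_coset_def)
    then have ky: "Poly_Mapping.keys y \<subseteq> \<Omega>" using G_submoduleD(1)[OF U u(1)] x keys_add[of u x] by blast
    have "scalar_mult r y - scalar_mult r x = scalar_mult r u" by (simp add: u scalar_mult_add)
    then show ?thesis
      using coset_eq_iff[of "scalar_mult r y" "scalar_mult r x"] keys_scalar_mult[OF r] ky x G_submodule_scalar_mult[OF U u(1) r] by simp
  qed
  then have "(\<Union>y\<in>U #>\<^bsub>A\<^esub> x. U #>\<^bsub>A\<^esub> scalar_mult r y) = (\<Union>y\<in>U #>\<^bsub>A\<^esub> x. U #>\<^bsub>A\<^esub> scalar_mult r x)"
    by (rule SUP_cong[OF refl])
  moreover have "x \<in> U #>\<^bsub>A\<^esub> x"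
    using A.rcos_self[OF _ G_submodule_subgroup[OF U]] x by simp
  ultimately show ?thesis by (auto simp: quotient_module_def)
qed

lemma carrier_quotient_module: "carrier (quotient_module U) = (\<lambda>x. U #>\<^bsub>A\<^esub> x) ` {x. Poly_Mapping.keys x \<subseteq> \<Omega>}"
  by (auto simp: quotient_module_def carrier_FactGroup)

text \<open>
  Every module axiom holds for representatives, by the laws of \<open>translate\<close> and \<open>scalar_mult\<close>.
\<close>

lemma left_module_quotient_module: "left_module (group_ring G) (quotient_module U)"
proof -
  have ka: "Poly_Mapping.keys (r + s) \<subseteq> B" if "Poly_Mapping.keys r \<subseteq> B" "Poly_Mapping.keys s \<subseteq> B"
    for r s :: "'z \<Rightarrow>\<^sub>0 int" and B using that keys_add[of r s] by blast
  have zero: "\<zero>\<^bsub>quotient_module U\<^esub> = U #>\<^bsub>A\<^esub> 0"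
    by (simp add: quotient_module_def coset_zero)
  have ab: "abelian_group (quotient_module U)"
  proof (rule abelian_groupI)
    fix X assume "X \<in> carrier (quotient_module U)"
    then obtain x where "X = U #>\<^bsub>A\<^esub> x" "Poly_Mapping.keys x \<subseteq> \<Omega>" by (auto simp: carrier_quotient_module)
    then show "\<exists>Y\<in>carrier (quotient_module U). Y \<oplus>\<^bsub>quotient_module U\<^esub> X = \<zero>\<^bsub>quotient_module U\<^esub>"
      by (intro bexI[of _ "U #>\<^bsub>A\<^esub> (- x)"]) (auto simp: carrier_quotient_module quotient_module_add zero)
  qed (auto simp: carrier_quotient_module quotient_module_add zero ka ac_simps)
  have c: "carrier (group_ring G :: ('a \<Rightarrow>\<^sub>0 int) ring) = {f. Poly_Mapping.keys f \<subseteq> carrier G}"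
    "add (group_ring G :: ('a \<Rightarrow>\<^sub>0 int) ring) = (+)" "one (group_ring G :: ('a \<Rightarrow>\<^sub>0 int) ring) = frag_of \<one>"
    by (simp_all add: group_ring_def)
  have m: "Poly_Mapping.keys (r \<otimes>\<^bsub>group_ring G\<^esub> s) \<subseteq> carrier G"
    if "Poly_Mapping.keys r \<subseteq> carrier G" "Poly_Mapping.keys s \<subseteq> carrier G" for r s :: "'a \<Rightarrow>\<^sub>0 int"
    using ring.ring_simprules(5)[OF ring_group_ring[OF is_group], of r s] that by (simp add: c)
  show ?thesis
    by (intro left_module.intro left_module_axioms.intro ring_group_ring is_group ab)
      (auto simp: c carrier_quotient_module quotient_module_smult quotient_module_add keys_scalar_mult scalar_mult_add ka scalar_mult_mult m translate_one
        keys_translate)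
qed

text \<open>
  The cosets of one point from each orbit generate: translation reaches every other point, and \<open>\<int>\<Omega>\<close> is
  additively generated by points.
\<close>

lemma finitely_generated_quotient_module:
  assumes B: "finite B" "B \<subseteq> \<Omega>" "\<And>w. w \<in> \<Omega> \<Longrightarrow> \<exists>g\<in>carrier G. \<exists>b\<in>B. w = act g b"
  shows "finitely_generated_module (group_ring G) (quotient_module U)"
  unfolding finitely_generated_module_def
proof (intro exI[of _ "(\<lambda>b. U #>\<^bsub>A\<^esub> frag_of b) ` B"] conjI allI impI)
  show "(\<lambda>b. U #>\<^bsub>A\<^esub> frag_of b) ` B \<subseteq> carrier (quotient_module U)"
    using B(2) by (auto simp: carrier_quotient_module)
  fix N assume N: "submodule N (group_ring G) (quotient_module U) \<and> (\<lambda>b. U #>\<^bsub>A\<^esub> frag_of b) ` B \<subseteq> N"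
  interpret M: left_module "group_ring G" "quotient_module U" by (rule left_module_quotient_module)
  interpret N: submodule N "group_ring G" "quotient_module U" using N by simp
  have sm: "r \<odot>\<^bsub>quotient_module U\<^esub> y \<in> N" if "Poly_Mapping.keys r \<subseteq> carrier G" "y \<in> N" for r y
    using N.smult_closed[of r y] that by (simp add: group_ring_def)
  have "U #>\<^bsub>A\<^esub> x \<in> N" if "Poly_Mapping.keys x \<subseteq> \<Omega>" for x
  proof -
    have "Poly_Mapping.keys x \<subseteq> \<Omega> \<and> U #>\<^bsub>A\<^esub> x \<in> N"
      using that
    proof (induction x rule: frag_induction)
      case zero
      show ?case using N.one_closed by (simp add: quotient_module_def coset_zero)
    next
      case (one w)
      then obtain g b where g: "g \<in> carrier G" "b \<in> B" "w = act g b" using B(3) by blast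
      have "frag_of g \<odot>\<^bsub>quotient_module U\<^esub> (U #>\<^bsub>A\<^esub> frag_of b) \<in> N"
        using N g by (intro sm) auto
      then show ?case using g one B(2) by (simp add: quotient_module_smult subset_iff)
    next
      case (diff x y)
      have "- frag_of \<one> \<odot>\<^bsub>quotient_module U\<^esub> (U #>\<^bsub>A\<^esub> y) \<in> N"
        using diff by (intro sm) auto
      then have "U #>\<^bsub>A\<^esub> (- y) \<in> N"
        using diff scalar_mult_simps(3)[of 0 "frag_of \<one>" y]
        by (simp add: quotient_module_smult translate_one)
      then have "(U #>\<^bsub>A\<^esub> x) \<oplus>\<^bsub>quotient_module U\<^esub> (U #>\<^bsub>A\<^esub> (- y)) \<in> N"
        using diff N.m_closed by simp
      then show ?case using diff keys_diff[of x y] by (auto simp: quotient_module_add)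
    qed
    then show ?thesis ..
  qed
  then show "N = carrier (quotient_module U)"
    using N.subset by (auto simp: carrier_quotient_module)
qed (use B(1) in simp)

end

end

section \<open>Chains of submodules under the Hall property\<close>

lemma frag_cmul_diff_distrib2: "frag_cmul c (a - b) = frag_cmul c a - frag_cmul c b"
  by (rule poly_mapping_eqI) (simp add: lookup_minus algebra_simps)

locale hall_G_set = G_set G act \<Omega>
  for G :: "('a, 'b) monoid_scheme" (structure) and act :: "'a \<Rightarrow> 'x \<Rightarrow> 'x" and \<Omega> :: "'x set" +
  assumes hall: "hall_property G"
    and finite_orbits: "\<exists>B. finite B \<and> B \<subseteq> \<Omega> \<and> (\<forall>w\<in>\<Omega>. \<exists>g\<in>carrier G. \<exists>b\<in>B. w = act g b)"
begin

text \<open>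
  The additive group of the module record carries a further field, so it is only isomorphic to the
  quotient group, by the identity map.
\<close>

lemma hall_quotient:
  assumes U: "G_submodule U"
  obtains \<pi> where "finite \<pi>" "free_by_torsion \<pi> (A Mod U)"
proof -
  interpret A: comm_group A by (rule abelian_free_Abelian_group)
  interpret M: left_module "group_ring G" "quotient_module U" by (rule left_module_quotient_module[OF U])
  obtain B where "finite B" "B \<subseteq> \<Omega>" "\<And>w. w \<in> \<Omega> \<Longrightarrow> \<exists>g\<in>carrier G. \<exists>b\<in>B. w = act g b"
    using finite_orbits by blast
  then have "finitely_generated_module (group_ring G) (quotient_module U)"
    by (rule finitely_generated_quotient_module[OF U])
  then obtain \<pi> where \<pi>: "finite \<pi>" "free_by_torsion \<pi> (add_monoid (quotient_module U))"
    using hall_property_module[OF hall left_module_quotient_module[OF U]] by blast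
  interpret N: normal U A using G_submodule_subgroup[OF U] by (simp add: A.normal_iff_subgroup)
  have "id \<in> Group.iso (add_monoid (quotient_module U)) (A Mod U)"
    by (auto simp: iso_iff hom_def quotient_module_def FactGroup_def N.setmult_closed)
  then have "free_by_torsion \<pi> (A Mod U)"
    using free_by_torsion_iso[OF M.M.a_comm_group A.abelian_FactGroup[OF G_submodule_subgroup[OF U]]] \<pi>(2)
    by blast
  with \<pi>(1) show thesis by (rule that)
qed

lemma hall_quotient_prime_torsion:
  assumes U: "G_submodule U"
  obtains \<pi> where "finite \<pi>"
    "\<And>p x. \<lbrakk>Factorial_Ring.prime (p::nat); Poly_Mapping.keys x \<subseteq> \<Omega>; x \<notin> U; frag_cmul (int p) x \<in> U\<rbrakk> \<Longrightarrow> p \<in> \<pi>"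
proof -
  interpret A: comm_group A by (rule abelian_free_Abelian_group)
  interpret N: normal U A using G_submodule_subgroup[OF U] by (simp add: A.normal_iff_subgroup)
  interpret Q: comm_group "A Mod U" by (rule A.abelian_FactGroup[OF G_submodule_subgroup[OF U]])
  obtain \<pi> where \<pi>: "finite \<pi>" "free_by_torsion \<pi> (A Mod U)" using hall_quotient[OF U] .
  have "p \<in> \<pi>" if "Factorial_Ring.prime (p::nat)" "Poly_Mapping.keys x \<subseteq> \<Omega>" "x \<notin> U" "frag_cmul (int p) x \<in> U"
    for p x
  proof (rule Q.free_by_torsion_prime_torsion[OF \<pi>(2)])
    show "U #>\<^bsub>A\<^esub> x \<in> carrier (A Mod U)" using that by (auto simp: carrier_FactGroup)
    show "U #>\<^bsub>A\<^esub> x \<noteq> \<one>\<^bsub>A Mod U\<^esub>"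
      using coset_eq_iff[OF U, of x 0] that by (simp add: coset_zero[OF U])
    show "(U #>\<^bsub>A\<^esub> x) [^]\<^bsub>A Mod U\<^esub> p = \<one>\<^bsub>A Mod U\<^esub>"
      using coset_eq_iff[OF U, of "frag_cmul (int p) x" 0] that
        order_trans[OF keys_cmul, of x \<Omega> "int p"]
      by (simp add: N.FactGroup_pow coset_zero[OF U])
  qed fact
  with \<pi>(1) show thesis by (rule that)
qed

lemma hall_quotient_finite_divisors:
  assumes U: "G_submodule U"
    and pure: "\<And>y k. \<lbrakk>Poly_Mapping.keys y \<subseteq> \<Omega>; k \<noteq> 0; frag_cmul k y \<in> U\<rbrakk> \<Longrightarrow> y \<in> U"
    and x: "Poly_Mapping.keys x \<subseteq> \<Omega>" "x \<notin> U"
  shows "finite {p::nat. Factorial_Ring.prime p \<and> (\<exists>y. Poly_Mapping.keys y \<subseteq> \<Omega> \<and> x - frag_cmul (int p) y \<in> U)}"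
proof -
  interpret A: comm_group A by (rule abelian_free_Abelian_group)
  interpret N: normal U A using G_submodule_subgroup[OF U] by (simp add: A.normal_iff_subgroup)
  interpret Q: comm_group "A Mod U" by (rule A.abelian_FactGroup[OF G_submodule_subgroup[OF U]])
  obtain \<pi> where \<pi>: "finite \<pi>" "free_by_torsion \<pi> (A Mod U)" using hall_quotient[OF U] .
  have pow: "(U #>\<^bsub>A\<^esub> y) [^]\<^bsub>A Mod U\<^esub> n = U #>\<^bsub>A\<^esub> frag_cmul (int n) y" if "Poly_Mapping.keys y \<subseteq> \<Omega>" for y and n :: nat
    using that by (simp add: N.FactGroup_pow)
  have k: "Poly_Mapping.keys (frag_cmul n y) \<subseteq> \<Omega>" if "Poly_Mapping.keys y \<subseteq> \<Omega>" for n y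
    using that keys_cmul[of n y] by blast
  have "finite {p::nat. Factorial_Ring.prime p \<and> (\<exists>Y\<in>carrier (A Mod U). U #>\<^bsub>A\<^esub> x = Y [^]\<^bsub>A Mod U\<^esub> p)}"
  proof (rule Q.free_by_torsion_finite_divisors[OF \<pi>(2,1)])
    fix Y and n :: nat
    assume "Y \<in> carrier (A Mod U)" "n \<noteq> 0" and n: "Y [^]\<^bsub>A Mod U\<^esub> n = \<one>\<^bsub>A Mod U\<^esub>"
    then obtain y where y: "Poly_Mapping.keys y \<subseteq> \<Omega>" "Y = U #>\<^bsub>A\<^esub> y" by (auto simp: carrier_FactGroup)
    have "frag_cmul (int n) y \<in> U"
      using n coset_eq_iff[OF U, of "frag_cmul (int n) y" 0] y k by (simp add: pow coset_zero[OF U])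
    then have "y \<in> U" using pure[of y "int n"] y \<open>n \<noteq> 0\<close> by simp
    then show "Y = \<one>\<^bsub>A Mod U\<^esub>"
      using coset_eq_iff[OF U, of y 0] y by (simp add: coset_zero[OF U])
  next
    show "U #>\<^bsub>A\<^esub> x \<in> carrier (A Mod U)" using x by (auto simp: carrier_FactGroup)
    show "U #>\<^bsub>A\<^esub> x \<noteq> \<one>\<^bsub>A Mod U\<^esub>"
      using coset_eq_iff[OF U, of x 0] x by (simp add: coset_zero[OF U])
  qed
  moreover have "\<exists>Y\<in>carrier (A Mod U). U #>\<^bsub>A\<^esub> x = Y [^]\<^bsub>A Mod U\<^esub> p"
    if y: "Poly_Mapping.keys y \<subseteq> \<Omega>" "x - frag_cmul (int p) y \<in> U" for p y
    using y coset_eq_iff[OF U x(1) k[OF y(1)]]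
    by (intro bexI[of _ "U #>\<^bsub>A\<^esub> y"]) (auto simp: pow carrier_FactGroup)
  ultimately show ?thesis
    by (rule_tac finite_subset[rotated]) blast+
qed

text \<open>
  The pure closure of \<open>U\<close>: the preimage of the torsion subgroup of \<open>\<int>\<Omega> / U\<close>.
\<close>

definition purification :: "('x \<Rightarrow>\<^sub>0 int) set \<Rightarrow> ('x \<Rightarrow>\<^sub>0 int) set" where
  "purification U = {y. Poly_Mapping.keys y \<subseteq> \<Omega> \<and> (\<exists>k. k \<noteq> 0 \<and> frag_cmul k y \<in> U)}"

lemma G_submodule_purification:
  assumes U: "G_submodule U"
  shows "G_submodule (purification U)"
proof (rule G_submoduleI)
  show "0 \<in> purification U" using G_submoduleD(2)[OF U] by (auto simp: purification_def intro: exI[of _ 1])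
  fix x y assume "x \<in> purification U" "y \<in> purification U"
  then obtain k l where xy: "Poly_Mapping.keys x \<subseteq> \<Omega>" "Poly_Mapping.keys y \<subseteq> \<Omega>"
    and kl: "k \<noteq> 0" "l \<noteq> 0" "frag_cmul k x \<in> U" "frag_cmul l y \<in> U"
    by (auto simp: purification_def)
  have "frag_cmul l (frag_cmul k x) - frag_cmul k (frag_cmul l y) \<in> U"
    by (rule G_submoduleD(3)[OF U G_submoduleD(7)[OF U kl(3)] G_submoduleD(7)[OF U kl(4)]])
  moreover have "frag_cmul l (frag_cmul k x) - frag_cmul k (frag_cmul l y) = frag_cmul (k * l) (x - y)"
    by (rule poly_mapping_eqI) (simp add: lookup_minus algebra_simps)
  ultimately show "x - y \<in> purification U"
    using xy kl keys_diff[of x y] by (auto simp: purification_def intro!: exI[of _ "k * l"])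
next
  fix g x assume "g \<in> carrier G" "x \<in> purification U"
  then show "translate g x \<in> purification U"
    using G_submoduleD(4)[OF U] keys_translate by (fastforce simp: purification_def simp flip: translate_simps(6))
qed (auto simp: purification_def)

lemma purification_pure:
  assumes "Poly_Mapping.keys y \<subseteq> \<Omega>" "k \<noteq> 0" "frag_cmul k y \<in> purification U"
  shows "y \<in> purification U"
  using assms by (auto simp: purification_def) (metis mult_eq_0_iff)

lemma subset_purification: "G_submodule U \<Longrightarrow> U \<subseteq> purification U"
  by (auto simp: purification_def dest: G_submoduleD(1) intro!: exI[of _ 1])

text \<open>
  This is the submodule \<open>U + n \<int>\<Omega>\<close>.
\<close>

lemma G_submodule_add_multiples:
  assumes U: "G_submodule U"
  shows "G_submodule {x. Poly_Mapping.keys x \<subseteq> \<Omega> \<and> (\<exists>y. Poly_Mapping.keys y \<subseteq> \<Omega> \<and> x - frag_cmul n y \<in> U)}" (is "G_submodule ?V")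
proof (rule G_submoduleI)
  show "0 \<in> ?V" using G_submoduleD(2)[OF U] by (auto intro!: exI[of _ 0])
  fix x x' assume "x \<in> ?V" "x' \<in> ?V"
  then obtain y y' where k: "Poly_Mapping.keys x \<subseteq> \<Omega>" "Poly_Mapping.keys y \<subseteq> \<Omega>" "Poly_Mapping.keys x' \<subseteq> \<Omega>" "Poly_Mapping.keys y' \<subseteq> \<Omega>"
    and U': "x - frag_cmul n y \<in> U" "x' - frag_cmul n y' \<in> U" by auto
  have "x - x' - frag_cmul n (y - y') = (x - frag_cmul n y) - (x' - frag_cmul n y')"
    by (simp add: frag_cmul_diff_distrib2)
  then have "x - x' - frag_cmul n (y - y') \<in> U" by (simp only: G_submoduleD(3)[OF U U'])
  then show "x - x' \<in> ?V" using k keys_diff[of x x'] keys_diff[of y y'] by blast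
next
  fix g x assume g: "g \<in> carrier G" and "x \<in> ?V"
  then obtain y where k: "Poly_Mapping.keys x \<subseteq> \<Omega>" "Poly_Mapping.keys y \<subseteq> \<Omega>" and "x - frag_cmul n y \<in> U" by auto
  then have "translate g (x - frag_cmul n y) \<in> U" using G_submoduleD(4)[OF U g] by blast
  then show "translate g x \<in> ?V" using keys_translate[OF g] k by auto
qed auto

text \<open>
  The central consequence of the Hall property. In the proof, \<open>V p i\<close> is \<open>K i + p \<int>\<Omega>\<close>.
\<close>

theorem eventually_torsion_over_span:
  fixes x :: "nat \<Rightarrow> 'x \<Rightarrow>\<^sub>0 int"
  assumes x: "\<And>i. Poly_Mapping.keys (x i) \<subseteq> \<Omega>"
  shows "\<exists>i k. k \<noteq> 0 \<and> frag_cmul k (x i) \<in> G_span (x ` {..<i})"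
proof (rule ccontr)
  assume neg: "\<not> ?thesis"
  define K where "K i = purification (G_span (x ` {..<i}))" for i
  define V where "V p i = {z. Poly_Mapping.keys z \<subseteq> \<Omega> \<and> (\<exists>y. Poly_Mapping.keys y \<subseteq> \<Omega> \<and> z - frag_cmul (int p) y \<in> K i)}" for p :: nat and i
  have S: "G_submodule (G_span (x ` {..<i}))" for i using x by (intro G_submodule_G_span) auto
  have K: "G_submodule (K i)" for i unfolding K_def by (rule G_submodule_purification[OF S])
  have V: "G_submodule (V p i)" for p i unfolding V_def by (rule G_submodule_add_multiples[OF K])
  have KV: "K i \<subseteq> V p i" for p i
    using G_submoduleD(1)[OF K] by (auto simp: V_def intro!: exI[of _ 0])
  have xK: "x i \<notin> K i" for i
    using neg by (auto simp: K_def purification_def)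
  have xK': "x j \<in> K i" if "j < i" for i j
    using subset_purification[OF S, of i] G_span_superset[of "x ` {..<i}"] that unfolding K_def by blast
  have fin: "finite {p::nat. Factorial_Ring.prime p \<and> x i \<in> V p i}" for i
  proof -
    have "finite {p::nat. Factorial_Ring.prime p \<and> (\<exists>y. Poly_Mapping.keys y \<subseteq> \<Omega> \<and> x i - frag_cmul (int p) y \<in> K i)}"
      using purification_pure unfolding K_def[symmetric]
      by (intro hall_quotient_finite_divisors K x xK) (auto simp: K_def intro: purification_pure)
    then show ?thesis using x by (simp add: V_def)
  qed
  have "\<exists>p>m. Factorial_Ring.prime p \<and> x i \<notin> V p i" for m :: nat and i
  proof -
    have "infinite ({p. Factorial_Ring.prime p} - {p::nat. Factorial_Ring.prime p \<and> x i \<in> V p i})"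
      using primes_infinite fin[of i] by (rule Diff_infinite_finite[rotated])
    then show ?thesis unfolding infinite_nat_iff_unbounded by blast
  qed
  \<comment> \<open>Strictly increasing primes are in particular distinct, which makes \<open>n i\<close> below prime to \<open>p i\<close>.\<close>
  then have "\<exists>p. \<forall>i. (Factorial_Ring.prime (p i) \<and> x i \<notin> V (p i) i) \<and> p i < p (Suc i)"
    by (intro dependent_nat_choice) blast+
  then obtain p :: "nat \<Rightarrow> nat" where p: "\<And>i. Factorial_Ring.prime (p i)" "\<And>i. x i \<notin> V (p i) i" "\<And>i. p i < p (Suc i)"
    by blast
  have mono: "strict_mono p" using p(3) by (simp add: strict_mono_Suc_iff)
  define n where "n i = (\<Prod>j<i. p j)" for i
  define L where "L = G_span (range (\<lambda>j. frag_cmul (int (n (Suc j))) (x j)))"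
  have kc: "Poly_Mapping.keys (frag_cmul c (x j)) \<subseteq> \<Omega>" for c j
    using x[of j] keys_cmul[of c "x j"] by blast
  have L: "G_submodule L" unfolding L_def using kc by (intro G_submodule_G_span) auto
  \<comment> \<open>The factor \<open>p i\<close> occurs in the generators with index at least \<open>i\<close>, and the earlier ones lie in \<open>K i\<close>.\<close>
  have LV: "L \<subseteq> V (p i) i" for i
    unfolding L_def
  proof (rule G_span_minimal[OF V], clarify)
    fix j
    show "frag_cmul (int (n (Suc j))) (x j) \<in> V (p i) i"
    proof (cases "j < i")
      case True
      then show ?thesis using xK' KV G_submoduleD(7)[OF K] by blast
    next
      case False
      then have "p i dvd n (Suc j)" unfolding n_def by (intro dvd_prodI) auto
      then obtain c where "n (Suc j) = p i * c" by blast
      then have "frag_cmul (int (n (Suc j))) (x j) - frag_cmul (int (p i)) (frag_cmul (int c) (x j)) = 0" by simp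
      then show ?thesis using kc G_submoduleD(2)[OF K] unfolding V_def by (metis (mono_tags, lifting) mem_Collect_eq)
    qed
  qed
  obtain \<pi> where \<pi>: "finite \<pi>"
    "\<And>p z. \<lbrakk>Factorial_Ring.prime (p::nat); Poly_Mapping.keys z \<subseteq> \<Omega>; z \<notin> L; frag_cmul (int p) z \<in> L\<rbrakk> \<Longrightarrow> p \<in> \<pi>"
    using hall_quotient_prime_torsion[OF L] by blast
  have "p i \<in> \<pi>" for i
  proof (rule \<pi>(2)[of _ "frag_cmul (int (n i)) (x i)"])
    show "frag_cmul (int (p i)) (frag_cmul (int (n i)) (x i)) \<in> L"
      using G_span_superset[of "range (\<lambda>j. frag_cmul (int (n (Suc j))) (x j))"]
      by (auto simp: L_def n_def mult.commute)
    show "frag_cmul (int (n i)) (x i) \<notin> L"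
    proof
      assume "frag_cmul (int (n i)) (x i) \<in> L"
      then have *: "frag_cmul (int (n i)) (x i) \<in> V (p i) i" using LV by blast
      have **: "frag_cmul (int (p i)) (x i) \<in> V (p i) i"
        using kc x G_submoduleD(2)[OF K] by (auto simp: V_def intro!: exI[of _ "x i"])
      have "coprime (n i) (p i)"
        unfolding n_def
      proof (rule prod_coprime_left)
        fix j assume "j \<in> {..<i}"
        then have "p j \<noteq> p i" using strict_mono_less[OF mono, of j i] by simp
        then show "coprime (p j) (p i)" using p(1) by (intro primes_coprime)
      qed
      then have "coprime (int (n i)) (int (p i))" by simp
      then obtain a b where "a * int (n i) + b * int (p i) = 1" by (metis bezout_int coprime_imp_gcd_eq_1)
      then have "x i = frag_cmul a (frag_cmul (int (n i)) (x i)) + frag_cmul b (frag_cmul (int (p i)) (x i))"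
        by (simp flip: frag_cmul_distrib)
      moreover have "\<dots> \<in> V (p i) i"
        by (rule G_submoduleD(6)[OF V G_submoduleD(7)[OF V *] G_submoduleD(7)[OF V **]])
      ultimately show False using p(2) by metis
    qed
  qed (use p kc in auto)
  then have "range p \<subseteq> \<pi>" by blast
  then have "finite (range p)" using \<pi>(1) finite_subset by blast
  then show False using strict_mono_imp_inj_on[OF mono] range_inj_infinite by blast
qed

end

text \<open>
  Turns the failure of finite generation, for any notion of closure \<open>P S y\<close> ("\<open>y\<close> is generated by \<open>S\<close>"), into
  an infinite sequence to which \<open>eventually_torsion_over_span\<close> applies.
\<close>

lemma sequence_avoiding_closure:
  assumes "\<And>S. \<lbrakk>finite S; S \<subseteq> J\<rbrakk> \<Longrightarrow> \<exists>y\<in>J. \<not> P S y"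
  shows "\<exists>x :: nat \<Rightarrow> 'a. \<forall>i. x i \<in> J \<and> \<not> P (x ` {..<i}) (x i)"
proof (rule dependent_wellorder_choice)
  fix r and f g :: "nat \<Rightarrow> 'a" and i assume "\<And>j. j < i \<Longrightarrow> f j = g j"
  then have "f ` {..<i} = g ` {..<i}" by auto
  then show "(r \<in> J \<and> \<not> P (f ` {..<i}) r) = (r \<in> J \<and> \<not> P (g ` {..<i}) r)" by simp
next
  fix i and f :: "nat \<Rightarrow> 'a" assume *: "\<And>j. j < i \<Longrightarrow> f j \<in> J \<and> \<not> P (f ` {..<j}) (f j)"
  have "f ` {..<i} \<subseteq> J"
  proof (rule image_subsetI)
    show "f j \<in> J" if "j \<in> {..<i}" for j using *[of j] that by simp
  qed
  then have "\<exists>y\<in>J. \<not> P (f ` {..<i}) y" by (intro assms finite_imageI finite_lessThan)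
  then show "\<exists>r. r \<in> J \<and> \<not> P (f ` {..<i}) r" by blast
qed

context hall_G_set
begin

theorem finitely_generated_up_to_torsion:
  assumes J: "G_submodule J"
  shows "\<exists>S. finite S \<and> S \<subseteq> J \<and> (\<forall>y\<in>J. \<exists>k. k \<noteq> 0 \<and> frag_cmul k y \<in> G_span S)"
proof (rule ccontr)
  assume neg: "\<not> ?thesis"
  have "\<exists>y\<in>J. \<not> (\<exists>k. k \<noteq> 0 \<and> frag_cmul k y \<in> G_span S)" if "finite S" "S \<subseteq> J" for S
    using neg that by blast
  from sequence_avoiding_closure[OF this, of "\<lambda>S. S"]
  obtain x :: "nat \<Rightarrow> 'x \<Rightarrow>\<^sub>0 int" where x: "\<And>i. x i \<in> J"
    "\<And>i. \<not> (\<exists>k. k \<noteq> 0 \<and> frag_cmul k (x i) \<in> G_span (x ` {..<i}))"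
    by blast
  have "\<exists>i k. k \<noteq> 0 \<and> frag_cmul k (x i) \<in> G_span (x ` {..<i})"
    by (rule eventually_torsion_over_span) (rule G_submoduleD(1)[OF J x(1)])
  with x(2) show False by blast
qed

end

section \<open>Noetherianity of the rational group ring\<close>

lemma common_denominator:
  "finite A \<Longrightarrow> \<exists>d::int. d \<noteq> 0 \<and> (\<forall>q\<in>A. \<exists>z. of_int d * (q::rat) = of_int z)"
proof (induction rule: finite_induct)
  case (insert q A)
  then obtain d where d: "d \<noteq> 0" "\<forall>q\<in>A. \<exists>z. of_int d * (q::rat) = of_int z" by blast
  obtain a b where ab': "quotient_of q = (a, b)" by (cases "quotient_of q")
  have ab: "q = of_int a / of_int b" "b \<noteq> 0"
    using quotient_of_div[OF ab'] quotient_of_denom_pos[OF ab'] by simp_all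
  have "\<exists>z. of_int (b * d) * r = of_int z" if r: "r \<in> A" for r :: rat
  proof -
    obtain z where "of_int d * r = of_int z" using d(2) r by blast
    then have "of_int (b * d) * r = of_int (b * z)" by simp
    then show ?thesis by (rule exI)
  qed
  moreover have "of_int (b * d) * q = of_int (a * d)" using ab by simp
  then have "\<exists>z. of_int (b * d) * q = of_int z" by (rule exI)
  moreover have "b * d \<noteq> 0" using d(1) ab(2) by simp
  ultimately show ?case by (metis insert_iff)
qed (rule exI[of _ 1], simp)

definition frag_to_rat :: "('x \<Rightarrow>\<^sub>0 int) \<Rightarrow> ('x \<Rightarrow>\<^sub>0 rat)" where
  "frag_to_rat = Poly_Mapping.map of_int"

lemma lookup_frag_to_rat [simp]: "Poly_Mapping.lookup (frag_to_rat y) w = of_int (Poly_Mapping.lookup y w)"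
  by (simp add: frag_to_rat_def Poly_Mapping.map.rep_eq when_def)

lemma keys_frag_to_rat [simp]: "Poly_Mapping.keys (frag_to_rat y) = Poly_Mapping.keys y"
  by (auto simp: in_keys_iff)

lemma frag_to_rat_simps [simp]:
  "frag_to_rat 0 = 0" "frag_to_rat (x - y) = frag_to_rat x - frag_to_rat y"
  "frag_to_rat (frag_cmul k (frag_of w)) = Poly_Mapping.single w (of_int k)"
  by (auto intro!: poly_mapping_eqI simp: lookup_minus lookup_single when_def)

lemma frag_to_rat_sum: "frag_to_rat (\<Sum>i\<in>I. f i) = (\<Sum>i\<in>I. frag_to_rat (f i))"
  by (rule poly_mapping_eqI) (simp add: lookup_sum)

context G_set
begin

text \<open>
  Multiplication by \<open>c g\<close> on \<open>\<rat>\<Omega>\<close>. Treating scalars and translations together covers with a single closure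
  condition what ideals are required to satisfy.
\<close>

definition rat_translate :: "'a \<Rightarrow> rat \<Rightarrow> ('x \<Rightarrow>\<^sub>0 rat) \<Rightarrow> ('x \<Rightarrow>\<^sub>0 rat)" where
  "rat_translate g c f = (\<Sum>w\<in>Poly_Mapping.keys f. Poly_Mapping.single (act g w) (c * Poly_Mapping.lookup f w))"

definition rat_submodule :: "('x \<Rightarrow>\<^sub>0 rat) set \<Rightarrow> bool" where
  "rat_submodule I \<longleftrightarrow> (\<forall>f\<in>I. Poly_Mapping.keys f \<subseteq> \<Omega>) \<and> 0 \<in> I \<and> (\<forall>f\<in>I. \<forall>h\<in>I. f - h \<in> I) \<and>
    (\<forall>g\<in>carrier G. \<forall>c. \<forall>f\<in>I. rat_translate g c f \<in> I)"

lemma rat_translate_frag_to_rat: "rat_translate g 1 (frag_to_rat y) = frag_to_rat (translate g y)"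
  by (simp add: rat_translate_def translate_def frag_extend_def frag_to_rat_sum)

lemma lookup_rat_translate_one:
  assumes "Poly_Mapping.keys f \<subseteq> \<Omega>"
  shows "Poly_Mapping.lookup (rat_translate \<one> c f) w = c * Poly_Mapping.lookup f w"
proof -
  have "rat_translate \<one> c f = (\<Sum>w\<in>Poly_Mapping.keys f. Poly_Mapping.single w (c * Poly_Mapping.lookup f w))"
    unfolding rat_translate_def using assms act_one by (intro sum.cong refl) (auto simp: subset_iff)
  then show ?thesis by (auto simp: lookup_sum lookup_single when_def sum.delta in_keys_iff)
qed

text \<open>
  Intersecting with the lattice \<open>\<int>\<Omega>\<close> loses nothing, since every element of \<open>\<rat>\<Omega>\<close> has a nonzero multiple
  in the lattice.
\<close>

lemma G_submodule_integral_part: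
  assumes I: "rat_submodule I"
  shows "G_submodule {y. Poly_Mapping.keys y \<subseteq> \<Omega> \<and> frag_to_rat y \<in> I}"
proof (rule G_submoduleI)
  fix g x assume "g \<in> carrier G" and x: "x \<in> {y. Poly_Mapping.keys y \<subseteq> \<Omega> \<and> frag_to_rat y \<in> I}"
  moreover from this have "rat_translate g 1 (frag_to_rat x) \<in> I" using I by (auto simp: rat_submodule_def)
  ultimately show "translate g x \<in> {y. Poly_Mapping.keys y \<subseteq> \<Omega> \<and> frag_to_rat y \<in> I}"
    using keys_translate by (simp add: rat_translate_frag_to_rat)
next
  fix x y assume "x \<in> {y. Poly_Mapping.keys y \<subseteq> \<Omega> \<and> frag_to_rat y \<in> I}" "y \<in> {y. Poly_Mapping.keys y \<subseteq> \<Omega> \<and> frag_to_rat y \<in> I}"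
  then show "x - y \<in> {y. Poly_Mapping.keys y \<subseteq> \<Omega> \<and> frag_to_rat y \<in> I}"
    using I keys_diff[of x y] by (auto simp: rat_submodule_def)
qed (use I in \<open>auto simp: rat_submodule_def\<close>)

lemma clear_denominators:
  assumes f: "Poly_Mapping.keys f \<subseteq> \<Omega>"
  obtains d :: int and y where "d \<noteq> 0" "Poly_Mapping.keys y \<subseteq> \<Omega>" "frag_to_rat y = rat_translate \<one> (of_int d) f"
proof -
  obtain d :: int where d: "d \<noteq> 0"
    "\<forall>q\<in>Poly_Mapping.lookup f ` Poly_Mapping.keys f. \<exists>z. of_int d * q = of_int z"
    using common_denominator[of "Poly_Mapping.lookup f ` Poly_Mapping.keys f"] by auto
  then obtain z where z: "\<And>w. w \<in> Poly_Mapping.keys f \<Longrightarrow> of_int d * Poly_Mapping.lookup f w = of_int (z w)"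
    by (simp add: image_iff) metis
  define y where "y = (\<Sum>w\<in>Poly_Mapping.keys f. frag_cmul (z w) (frag_of w))"
  have l: "Poly_Mapping.lookup y w = (if w \<in> Poly_Mapping.keys f then z w else 0)" for w
    unfolding y_def by (simp add: lookup_sum if_distrib[of "\<lambda>x. _ * x"] cong: if_cong)
  have "frag_to_rat y = rat_translate \<one> (of_int d) f"
    by (rule poly_mapping_eqI) (auto simp: l lookup_rat_translate_one[OF f] z in_keys_iff)
  moreover have "Poly_Mapping.keys y \<subseteq> \<Omega>"
  proof
    fix w assume "w \<in> Poly_Mapping.keys y"
    then have "w \<in> Poly_Mapping.keys f" using l[of w] by (metis in_keys_iff)
    then show "w \<in> \<Omega>" using f by blast
  qed
  ultimately show thesis by (intro that[OF d(1)])
qed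

end

context hall_G_set
begin

text \<open>
  Generators of the integral part up to torsion generate over \<open>\<rat>\<close>, where one can divide both by the
  common denominator of an element and by the multiplier that puts it into the span.
\<close>

theorem rational_submodules_finitely_generated:
  assumes I: "rat_submodule I"
  shows "\<exists>S. finite S \<and> S \<subseteq> I \<and> (\<forall>J. rat_submodule J \<and> S \<subseteq> J \<longrightarrow> I \<subseteq> J)"
proof -
  obtain S where S: "finite S" "S \<subseteq> {y. Poly_Mapping.keys y \<subseteq> \<Omega> \<and> frag_to_rat y \<in> I}"
    and gen: "\<forall>y\<in>{y. Poly_Mapping.keys y \<subseteq> \<Omega> \<and> frag_to_rat y \<in> I}. \<exists>k. k \<noteq> 0 \<and> frag_cmul k y \<in> G_span S"
    using finitely_generated_up_to_torsion[OF G_submodule_integral_part[OF I]] by (elim exE conjE)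
  have "f \<in> J" if J: "rat_submodule J" "frag_to_rat ` S \<subseteq> J" and f: "f \<in> I" for J f
  proof -
    have fk: "Poly_Mapping.keys f \<subseteq> \<Omega>" using f I by (auto simp: rat_submodule_def)
    obtain d y where d: "d \<noteq> (0::int)" and y: "Poly_Mapping.keys y \<subseteq> \<Omega>" "frag_to_rat y = rat_translate \<one> (of_int d) f"
      using clear_denominators[OF fk] .
    have "frag_to_rat y \<in> I" using I f y(2) one_closed by (simp add: rat_submodule_def)
    then obtain k where k: "k \<noteq> 0" "frag_cmul k y \<in> G_span S" using gen y(1) by blast
    have "G_span S \<subseteq> {y. Poly_Mapping.keys y \<subseteq> \<Omega> \<and> frag_to_rat y \<in> J}"
      using S(2) J by (intro G_span_minimal G_submodule_integral_part) auto
    then have *: "frag_to_rat (frag_cmul k y) \<in> J" using k(2) by blast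
    have "f = rat_translate \<one> (1 / (of_int k * of_int d)) (frag_to_rat (frag_cmul k y))"
    proof (rule poly_mapping_eqI)
      fix w
      have "of_int (Poly_Mapping.lookup y w) = of_int d * Poly_Mapping.lookup f w"
        using arg_cong[OF y(2), of "\<lambda>f. Poly_Mapping.lookup f w"] by (simp add: lookup_rat_translate_one[OF fk])
      moreover have "Poly_Mapping.keys (frag_to_rat (frag_cmul k y)) \<subseteq> \<Omega>" using y(1) by auto
      ultimately show "Poly_Mapping.lookup f w = Poly_Mapping.lookup (rat_translate \<one> (1 / (of_int k * of_int d)) (frag_to_rat (frag_cmul k y))) w"
        using d k(1) by (simp add: lookup_rat_translate_one)
    qed
    then show ?thesis using * J(1) one_closed unfolding rat_submodule_def by metis
  qed
  then show ?thesis using S by (intro exI[of _ "frag_to_rat ` S"]) auto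
qed

end

lemma hall_G_set_left_mult:
  assumes "group G" "hall_property G"
  shows "hall_G_set G (\<lambda>g h. g \<otimes>\<^bsub>G\<^esub> h) (carrier G)"
proof -
  interpret group G by fact
  show ?thesis
    by unfold_locales (use assms(2) in \<open>auto simp: m_assoc intro!: exI[of _ "{\<one>\<^bsub>G\<^esub>}"]\<close>)
qed

text \<open>
  The inverse makes right multiplication a left action, so that right ideals become submodules in the same sense as
  left ideals.
\<close>

lemma hall_G_set_right_mult:
  assumes "group G" "hall_property G"
  shows "hall_G_set G (\<lambda>g h. h \<otimes>\<^bsub>G\<^esub> inv\<^bsub>G\<^esub> g) (carrier G)"
proof -
  interpret group G by fact
  have "\<exists>g\<in>carrier G. w = \<one>\<^bsub>G\<^esub> \<otimes>\<^bsub>G\<^esub> inv\<^bsub>G\<^esub> g" if "w \<in> carrier G" for w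
    using that by (intro bexI[of _ "inv\<^bsub>G\<^esub> w"]) auto
  then show ?thesis
    by unfold_locales (use assms(2) in \<open>auto simp: m_assoc inv_mult_group intro!: exI[of _ "{\<one>\<^bsub>G\<^esub>}"]\<close>)
qed

lemma minus_closed_group_ring:
  assumes "group G" "additive_subgroup I (group_ring G :: ('a \<Rightarrow>\<^sub>0 'c::comm_ring_1) ring)"
    and x: "x \<in> I" "y \<in> I"
  shows "x - y \<in> I"
proof -
  let ?R = "group_ring G :: ('a \<Rightarrow>\<^sub>0 'c) ring"
  interpret R: ring ?R by (rule ring_group_ring) fact
  interpret I: additive_subgroup I ?R by fact
  have "- y \<oplus>\<^bsub>?R\<^esub> y = \<zero>\<^bsub>?R\<^esub>" "- y \<in> carrier ?R"
    using I.a_subset x by (auto simp: group_ring_def)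
  then have "\<ominus>\<^bsub>?R\<^esub> y = - y" using R.minus_equality I.a_subset x by blast
  then have "- y \<in> I" using I.a_inv_closed[OF x(2)] by simp
  then have "x \<oplus>\<^bsub>?R\<^esub> (- y) \<in> I" using x by blast
  then show ?thesis by (simp add: group_ring_def)
qed

theorem left_noetherian_group_ring:
  assumes G: "group G" "hall_property G"
  shows "left_noetherian (group_ring G :: ('a \<Rightarrow>\<^sub>0 rat) ring)"
proof -
  let ?R = "group_ring G :: ('a \<Rightarrow>\<^sub>0 rat) ring"
  interpret hall_G_set G "\<lambda>g h. g \<otimes>\<^bsub>G\<^esub> h" "carrier G" by (rule hall_G_set_left_mult[OF G])
  have q: "rat_submodule I" if I: "left_ideal I ?R" for I
    unfolding rat_submodule_def
  proof (intro conjI ballI allI)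
    interpret I: additive_subgroup I ?R using I by (simp add: left_ideal_def)
    show "Poly_Mapping.keys f \<subseteq> carrier G" if "f \<in> I" for f
      using I.a_subset that by (auto simp: group_ring_def)
    show "0 \<in> I" using I.zero_closed by (simp add: group_ring_def)
    show "f - h \<in> I" if "f \<in> I" "h \<in> I" for f h
      using minus_closed_group_ring[OF G(1) I.additive_subgroup_axioms that] .
    fix g c f assume g: "g \<in> carrier G" and f: "f \<in> I"
    have "Poly_Mapping.single g c \<otimes>\<^bsub>?R\<^esub> f = rat_translate g c f"
      by (subst group_ring_mult_superset[where A="{g}" and B="Poly_Mapping.keys f"]) (auto simp: rat_translate_def)
    moreover have "Poly_Mapping.single g c \<in> carrier ?R" using g by (simp add: group_ring_def)
    ultimately show "rat_translate g c f \<in> I" using I f unfolding left_ideal_def by metis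
  qed
  show ?thesis unfolding left_noetherian_def
    using rational_submodules_finitely_generated q ring_group_ring[OF G(1)] by meson
qed

theorem right_noetherian_group_ring:
  assumes G: "group G" "hall_property G"
  shows "right_noetherian (group_ring G :: ('a \<Rightarrow>\<^sub>0 rat) ring)"
proof -
  let ?R = "group_ring G :: ('a \<Rightarrow>\<^sub>0 rat) ring"
  interpret hall_G_set G "\<lambda>g h. h \<otimes>\<^bsub>G\<^esub> inv\<^bsub>G\<^esub> g" "carrier G" by (rule hall_G_set_right_mult[OF G])
  have q: "rat_submodule I" if I: "right_ideal I ?R" for I
    unfolding rat_submodule_def
  proof (intro conjI ballI allI)
    interpret I: additive_subgroup I ?R using I by (simp add: right_ideal_def)
    show "Poly_Mapping.keys f \<subseteq> carrier G" if "f \<in> I" for f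
      using I.a_subset that by (auto simp: group_ring_def)
    show "0 \<in> I" using I.zero_closed by (simp add: group_ring_def)
    show "f - h \<in> I" if "f \<in> I" "h \<in> I" for f h
      using minus_closed_group_ring[OF G(1) I.additive_subgroup_axioms that] .
    fix g c f assume g: "g \<in> carrier G" and f: "f \<in> I"
    have "f \<otimes>\<^bsub>?R\<^esub> Poly_Mapping.single (inv\<^bsub>G\<^esub> g) c = rat_translate g c f"
      by (subst group_ring_mult_superset[where A="Poly_Mapping.keys f" and B="{inv\<^bsub>G\<^esub> g}"])
        (auto simp: rat_translate_def mult.commute)
    moreover have "Poly_Mapping.single (inv\<^bsub>G\<^esub> g) c \<in> carrier ?R" using g by (simp add: group_ring_def)
    ultimately show "rat_translate g c f \<in> I" using I f unfolding right_ideal_def by metis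
  qed
  show ?thesis unfolding right_noetherian_def
    using rational_submodules_finitely_generated q ring_group_ring[OF G(1)] by meson
qed

section \<open>Subgroups are finitely generated\<close>

text \<open>
  Let \<open>K\<close> be generated by \<open>h j\<close>, \<open>j < i\<close>. The kernel of the equivariant map \<open>\<int>G \<rightarrow> \<int>[G/K]\<close> contains
  \<open>h j - 1\<close> for these \<open>j\<close>. If it contains a nonzero multiple of \<open>h i - 1\<close>, then \<open>h i\<close> lies in \<open>K\<close>.
\<close>

theorem subgroups_finitely_generated:
  assumes G: "group G" "hall_property G" and H: "subgroup H G"
  shows "\<exists>S. finite S \<and> S \<subseteq> H \<and> generate G S = H"
proof (rule ccontr)
  assume neg: "\<not> ?thesis"
  interpret hall_G_set G "\<lambda>g h. g \<otimes>\<^bsub>G\<^esub> h" "carrier G" by (rule hall_G_set_left_mult[OF G])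
  have HG: "H \<subseteq> carrier G" using H by (rule subgroup.subset)
  have "\<exists>h\<in>H. \<not> h \<in> generate G S" if "finite S" "S \<subseteq> H" for S
    using neg that generate_subgroup_incl[OF that(2) H] by blast
  from sequence_avoiding_closure[OF this, of "\<lambda>S. S"]
  obtain h :: "nat \<Rightarrow> _" where h: "\<And>i. h i \<in> H" "\<And>i. h i \<notin> generate G (h ` {..<i})" by blast
  define x where "x i = frag_of (h i) - frag_of \<one>\<^bsub>G\<^esub>" for i
  have "Poly_Mapping.keys (x i) \<subseteq> carrier G" for i
    unfolding x_def using h(1) HG by (intro order_trans[OF keys_diff]) auto
  note xG = this
  obtain i k where k: "k \<noteq> 0" "frag_cmul k (x i) \<in> G_span (x ` {..<i})"
    using eventually_torsion_over_span[of x, OF xG] by (elim exE conjE)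
  define K where "K = generate G (h ` {..<i})"
  have hK: "h ` {..<i} \<subseteq> carrier G" using h(1) HG by blast
  have K: "subgroup K G" unfolding K_def by (rule generate_is_subgroup[OF hK])
  have KG: "K \<subseteq> carrier G" using K by (rule subgroup.subset)
  define \<psi> where "\<psi> = frag_extend (frag_of \<circ> (\<lambda>a. a <#\<^bsub>G\<^esub> K))"
  have "G_submodule {y. Poly_Mapping.keys y \<subseteq> carrier G \<and> \<psi> y = 0}"
  proof (rule G_submoduleI)
    fix g y assume g: "g \<in> carrier G" and y: "y \<in> {y. Poly_Mapping.keys y \<subseteq> carrier G \<and> \<psi> y = 0}"
    have "\<psi> (translate g y) = frag_extend (\<lambda>a. frag_of ((g \<otimes>\<^bsub>G\<^esub> a) <#\<^bsub>G\<^esub> K)) y"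
      by (simp add: \<psi>_def translate_def frag_extend_compose) (simp add: comp_def)
    also have "\<dots> = frag_extend (\<lambda>a. frag_of (g <#\<^bsub>G\<^esub> (a <#\<^bsub>G\<^esub> K))) y"
      using y g KG by (intro frag_extend_eq) (auto simp: lcos_m_assoc)
    also have "\<dots> = frag_extend (frag_of \<circ> (\<lambda>X. g <#\<^bsub>G\<^esub> X)) (\<psi> y)"
      by (simp add: \<psi>_def frag_extend_compose) (simp add: comp_def)
    finally show "translate g y \<in> {y. Poly_Mapping.keys y \<subseteq> carrier G \<and> \<psi> y = 0}"
      using y keys_translate[OF g] by simp
  next
    fix y z assume "y \<in> {y. Poly_Mapping.keys y \<subseteq> carrier G \<and> \<psi> y = 0}" "z \<in> {y. Poly_Mapping.keys y \<subseteq> carrier G \<and> \<psi> y = 0}"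
    then show "y - z \<in> {y. Poly_Mapping.keys y \<subseteq> carrier G \<and> \<psi> y = 0}"
      using keys_diff[of y z] by (auto simp: \<psi>_def frag_extend_diff)
  qed (auto simp: \<psi>_def)
  moreover have \<psi>x: "\<psi> (x j) = frag_of (h j <#\<^bsub>G\<^esub> K) - frag_of K" for j
    using coset_join3[OF one_closed K subgroup.one_closed[OF K]]
    by (simp add: x_def \<psi>_def frag_extend_diff)
  have "h j <#\<^bsub>G\<^esub> K = K" if "j < i" for j
    using that h(1) HG by (intro coset_join3 K) (auto simp: K_def intro: generate.incl)
  ultimately have "G_span (x ` {..<i}) \<subseteq> {y. Poly_Mapping.keys y \<subseteq> carrier G \<and> \<psi> y = 0}"
    using xG \<psi>x by (intro G_span_minimal) auto
  then have "frag_cmul k (\<psi> (x i)) = 0" using k(2) by (auto simp: \<psi>_def frag_extend_cmul)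
  then have "h i <#\<^bsub>G\<^esub> K = K" using k(1) by (simp add: \<psi>x frag_of_eq)
  moreover have "h i \<in> h i <#\<^bsub>G\<^esub> K"
    unfolding l_coset_def
  proof (rule UN_I[OF subgroup.one_closed[OF K]])
    show "h i \<in> {h i \<otimes>\<^bsub>G\<^esub> \<one>\<^bsub>G\<^esub>}" using r_one[of "h i"] h(1)[of i] HG by auto
  qed
  ultimately show False using h(2) K_def by blast
qed

section \<open>The strong rank condition\<close>

definition free_act :: "('a, 'b) monoid_scheme \<Rightarrow> 'a \<Rightarrow> 'a \<times> nat \<Rightarrow> 'a \<times> nat" where
  "free_act G g p = (g \<otimes>\<^bsub>G\<^esub> fst p, snd p)"

lemma G_set_free_act:
  assumes "group G"
  shows "G_set G (free_act G) (carrier G \<times> J)"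
proof -
  interpret group G by fact
  show ?thesis by unfold_locales (auto simp: free_act_def m_assoc)
qed

lemma hall_G_set_free_act:
  assumes "group G" "hall_property G" "finite J"
  shows "hall_G_set G (free_act G) (carrier G \<times> J)"
proof -
  interpret G_set G "free_act G" "carrier G \<times> J" by (rule G_set_free_act) fact
  have "\<forall>w\<in>carrier G \<times> J. \<exists>g\<in>carrier G. \<exists>b\<in>{\<one>\<^bsub>G\<^esub>} \<times> J. w = free_act G g b"
    by (auto simp: free_act_def)
  then show ?thesis
    by (intro hall_G_set.intro hall_G_set_axioms.intro G_set_axioms assms(2) exI[of _ "{\<one>\<^bsub>G\<^esub>} \<times> J"])
      (use assms(3) in auto)
qed

text \<open>
  Write \<open>e\<close> for the last of the \<open>m + 1\<close> basis elements and let \<open>x\<^sub>i\<close> be \<open>e\<close> with \<open>\<alpha>\<close> applied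
  \<open>i + 1\<close> times. If \<open>\<alpha>\<close> is injective, then the elements \<open>x\<^sub>i\<close> span an infinite direct sum of free modules inside the
  free module of rank \<open>m\<close>: the first of them generates \<open>\<alpha>(\<int>G e)\<close>, the others lie in the image under \<open>\<alpha>\<close> of
  the free module of rank \<open>m\<close>, and these two submodules meet trivially. So no \<open>x\<^sub>i\<close> is torsion over its predecessors.
  The induction on \<open>i\<close> strips off one application of \<open>\<alpha>\<close>.
\<close>

theorem strong_rank_condition:
  fixes G :: "('a, 'b) monoid_scheme" and \<alpha> :: "('a \<times> nat \<Rightarrow>\<^sub>0 int) \<Rightarrow> ('a \<times> nat \<Rightarrow>\<^sub>0 int)"
  assumes G: "group G" "hall_property G"
    and diff: "\<And>x y. \<alpha> (x - y) = \<alpha> x - \<alpha> y"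
    and equivariant: "\<And>g x. \<lbrakk>g \<in> carrier G; Poly_Mapping.keys x \<subseteq> carrier G \<times> {..m}\<rbrakk> \<Longrightarrow>
      \<alpha> (G_set.translate (free_act G) g x) = G_set.translate (free_act G) g (\<alpha> x)"
    and keys: "\<And>x. Poly_Mapping.keys x \<subseteq> carrier G \<times> {..m} \<Longrightarrow> Poly_Mapping.keys (\<alpha> x) \<subseteq> carrier G \<times> {..<m}"
  shows "\<exists>x. Poly_Mapping.keys x \<subseteq> carrier G \<times> {..m} \<and> x \<noteq> 0 \<and> \<alpha> x = 0"
proof (rule ccontr)
  assume *: "\<not> ?thesis"
  have inj: "x = 0" if "Poly_Mapping.keys x \<subseteq> carrier G \<times> {..m}" "\<alpha> x = 0" for x
    using * that by blast
  interpret hall_G_set G "free_act G" "carrier G \<times> {..<m}" by (intro hall_G_set_free_act G) simp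
  interpret E: G_set G "free_act G" "carrier G \<times> {m}" by (intro G_set_free_act G)
  define e where "e = frag_of (\<one>\<^bsub>G\<^esub>, m)"
  define x where "x i = (\<alpha> ^^ Suc i) e" for i
  have x0: "x 0 = \<alpha> e" and xS: "x (Suc i) = \<alpha> (x i)" for i by (simp_all add: x_def)
  have le: "Poly_Mapping.keys z \<subseteq> carrier G \<times> {..m}" if "Poly_Mapping.keys z \<subseteq> carrier G \<times> {..<m}" for z :: "'a \<times> nat \<Rightarrow>\<^sub>0 int"
    using that by fastforce
  have em: "Poly_Mapping.keys z \<subseteq> carrier G \<times> {..m}" if "Poly_Mapping.keys z \<subseteq> carrier G \<times> {m}" for z :: "'a \<times> nat \<Rightarrow>\<^sub>0 int"
    using that by fastforce
  have add: "\<alpha> (u + v) = \<alpha> u + \<alpha> v" for u v using diff[of "u + v" v] by simp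
  have zero: "\<alpha> 0 = 0" using diff[of 0 0] by simp
  have cmul_nat: "\<alpha> (frag_cmul (int n) u) = frag_cmul (int n) (\<alpha> u)" for n u
    by (induction n) (simp_all add: zero add frag_cmul_distrib)
  have cmul: "\<alpha> (frag_cmul k u) = frag_cmul k (\<alpha> u)" for k u
  proof (cases k rule: int_cases2)
    case (nonpos n)
    have "\<alpha> (0 - frag_cmul (int n) u) = 0 - frag_cmul (int n) (\<alpha> u)" by (simp only: diff zero cmul_nat)
    then show ?thesis by (simp add: nonpos)
  qed (simp add: cmul_nat)
  have xk: "Poly_Mapping.keys (x i) \<subseteq> carrier G \<times> {..<m}" for i
    by (induction i) (simp_all add: x0 xS keys le e_def)
  have ek: "Poly_Mapping.keys e \<subseteq> carrier G \<times> {m}" by (simp add: e_def)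
  have False if "k \<noteq> 0" "frag_cmul k (x i) \<in> G_span (x ` {..<i})" for i k
    using that(2)
  proof (induction i)
    case 0
    have "G_span (x ` {..<0}) \<subseteq> {0}" by (rule G_span_minimal) (auto intro!: G_submoduleI)
    then have "\<alpha> (frag_cmul k e) = 0" using 0 by (auto simp: x0 cmul)
    then have "frag_cmul k e = 0" using inj[of "frag_cmul k e"] em[OF ek] keys_cmul[of k e] by blast
    then show False using that(1) by (simp add: e_def)
  next
    case (Suc i)
    let ?U = "G_span (x ` {..<i})"
    \<comment> \<open>A submodule that contains \<open>x 0, \<dots>, x i\<close> and makes the \<open>e\<close>-component of a relation visible.\<close>
    define W where "W = {\<alpha> (u + v) |u v. Poly_Mapping.keys u \<subseteq> carrier G \<times> {m} \<and> v \<in> ?U}"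
    have WI: "\<alpha> (u + v) \<in> W" if "Poly_Mapping.keys u \<subseteq> carrier G \<times> {m}" "v \<in> ?U" for u v
      using that unfolding W_def by blast
    have U: "G_submodule ?U" using xk by (intro G_submodule_G_span) auto
    have kuv: "Poly_Mapping.keys (u + v) \<subseteq> carrier G \<times> {..m}"
      if "Poly_Mapping.keys u \<subseteq> carrier G \<times> {m}" "v \<in> ?U" for u v
      using em[OF that(1)] le[OF G_submoduleD(1)[OF U that(2)]] keys_add[of u v] by blast
    have "G_submodule W"
    proof (rule G_submoduleI)
      show "Poly_Mapping.keys z \<subseteq> carrier G \<times> {..<m}" if z: "z \<in> W" for z
      proof -
        obtain u v where uv: "z = \<alpha> (u + v)" "v \<in> ?U" "Poly_Mapping.keys u \<subseteq> carrier G \<times> {m}"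
          using z unfolding W_def by blast
        show ?thesis unfolding uv(1) by (rule keys[OF kuv[OF uv(3,2)]])
      qed
      have "\<alpha> (0 + 0) \<in> W" by (rule WI[OF _ G_submoduleD(2)[OF U]]) simp
      then show "0 \<in> W" by (simp add: zero)
      fix z z' assume "z \<in> W" "z' \<in> W"
      then obtain u v u' v' where uv: "z = \<alpha> (u + v)" "z' = \<alpha> (u' + v')" "v \<in> ?U" "v' \<in> ?U"
        "Poly_Mapping.keys u \<subseteq> carrier G \<times> {m}" "Poly_Mapping.keys u' \<subseteq> carrier G \<times> {m}"
        unfolding W_def by blast
      have "z - z' = \<alpha> ((u - u') + (v - v'))" by (simp add: uv(1,2) add diff algebra_simps)
      moreover have "Poly_Mapping.keys (u - u') \<subseteq> carrier G \<times> {m}" using uv(5,6) keys_diff[of u u'] by blast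
      ultimately show "z - z' \<in> W" using WI G_submoduleD(3)[OF U uv(3,4)] by simp
    next
      fix g z assume g: "g \<in> carrier G" and "z \<in> W"
      then obtain u v where uv: "z = \<alpha> (u + v)" "v \<in> ?U" "Poly_Mapping.keys u \<subseteq> carrier G \<times> {m}"
        unfolding W_def by blast
      have "translate g z = \<alpha> (translate g u + translate g v)" using equivariant[OF g kuv[OF uv(3,2)]] by (simp add: uv(1))
      then show "translate g z \<in> W" using WI[OF E.keys_translate[OF g uv(3)] G_submoduleD(4)[OF U g uv(2)]] by simp
    qed
    moreover have "x ` {..<Suc i} \<subseteq> W"
    proof (rule image_subsetI)
      fix j assume j: "j \<in> {..<Suc i}"
      show "x j \<in> W"
      proof (cases j)
        case 0
        have "\<alpha> (e + 0) \<in> W" by (rule WI[OF ek G_submoduleD(2)[OF U]])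
        then show ?thesis by (simp add: 0 x0)
      next
        case (Suc l)
        have "x l \<in> x ` {..<i}" using j Suc by simp
        then have "x l \<in> ?U" by (rule subsetD[OF G_span_superset])
        then have "\<alpha> (0 + x l) \<in> W" by (intro WI) simp_all
        then show ?thesis by (simp add: Suc xS)
      qed
    qed
    ultimately have "frag_cmul k (x (Suc i)) \<in> W" using Suc.prems by (blast dest: G_span_minimal)
    then obtain u v where uv: "\<alpha> (frag_cmul k (x i)) = \<alpha> (u + v)" "v \<in> ?U" "Poly_Mapping.keys u \<subseteq> carrier G \<times> {m}"
      unfolding W_def by (auto simp: xS cmul)
    have kx: "Poly_Mapping.keys (frag_cmul k (x i)) \<subseteq> carrier G \<times> {..<m}"
      using xk keys_cmul[of k "x i"] by blast
    have "frag_cmul k (x i) - (u + v) = 0"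
    proof (rule inj)
      show "Poly_Mapping.keys (frag_cmul k (x i) - (u + v)) \<subseteq> carrier G \<times> {..m}"
        using le[OF kx] kuv[OF uv(3,2)] keys_diff[of "frag_cmul k (x i)" "u + v"] by blast
    qed (simp add: diff uv(1))
    then have eq: "u = frag_cmul k (x i) - v" by (simp add: algebra_simps)
    have "Poly_Mapping.keys u \<subseteq> carrier G \<times> {..<m}"
      using eq kx G_submoduleD(1)[OF U uv(2)] keys_diff[of "frag_cmul k (x i)" v] by blast
    with uv(3) have "Poly_Mapping.keys u = {}" by fastforce
    then have "frag_cmul k (x i) = v" using eq by simp
    then show False using Suc.IH uv(2) by blast
  qed
  then show False using eventually_torsion_over_span[of x, OF xk] by blast
qed

section \<open>Set families with many private points\<close>

lemma dyadic_scale: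
  assumes "d \<ge> (1::nat)"
  obtains k where "2 * d \<le> 2 ^ k" "2 ^ k < 4 * d"
proof -
  define k where "k = (LEAST k. 2 * d \<le> (2::nat) ^ k)"
  have ex: "2 * d \<le> (2::nat) ^ (2 * d)" by (rule less_imp_le) (rule less_exp)
  then have le: "2 * d \<le> 2 ^ k" unfolding k_def by (rule LeastI)
  have "k \<noteq> 0" using le assms by (cases k) auto
  then obtain j where j: "k = Suc j" by (cases k) auto
  have "\<not> 2 * d \<le> 2 ^ j" using not_less_Least[of j "\<lambda>k. 2 * d \<le> (2::nat) ^ k"] j unfolding k_def by simp
  then have "2 ^ k < 4 * d" using j by simp
  with le show thesis by (rule that)
qed

text \<open>
  A function into \<open>{..<D}\<close>, \<open>D = 2\<^sup>k E\<close>, that is random and has independent values lies below \<open>E\<close> at one given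
  place, but at none of \<open>d - 1\<close> others, with probability \<open>2\<^bsup>-k\<^esup> (1 - 2\<^bsup>-k\<^esup>)\<^bsup>d-1\<^esup>\<close>. If \<open>2\<^sup>k\<close> is between \<open>2 d\<close> and
  \<open>4 d\<close>, Bernoulli's inequality bounds this below by \<open>1 / (8 d)\<close>. The inequality is the same bound, as a count of
  functions on a set of \<open>N\<close> elements.
\<close>

lemma isolation_count:
  fixes d k E N :: nat
  assumes d: "1 \<le> d" "d \<le> N" and k: "2 * d \<le> 2 ^ k" "2 ^ k < 4 * d"
  shows "(2 ^ k * E) ^ N \<le> 8 * d * (E * (2 ^ k * E - E) ^ (d - 1) * (2 ^ k * E) ^ (N - d))"
proof -
  define q :: real where "q = 2 ^ k"
  define D :: real where "D = q * real E"
  have q: "2 * real d \<le> q" "q < 4 * real d"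
    using k unfolding q_def by (metis of_nat_le_iff of_nat_mult of_nat_numeral of_nat_power)
      (metis k(2) of_nat_less_iff of_nat_mult of_nat_numeral of_nat_power)
  have q1: "q \<ge> 1" and D: "D \<ge> 0" by (simp_all add: q_def D_def)
  have "1 / 2 \<le> 1 + real (d - 1) * (- 1 / q)"
    using q q1 d by (simp add: field_simps)
  also have "\<dots> \<le> (1 + (- 1 / q)) ^ (d - 1)"
    using q1 by (intro Bernoulli_inequality) (simp add: field_simps)
  finally have B: "1 / 2 \<le> (1 + (- 1 / q)) ^ (d - 1)" .
  have DE: "D - real E = D * (1 + (- 1 / q))" using q1 by (simp add: D_def field_simps)
  have "D ^ N = D * D ^ (d - 1) * D ^ (N - d)"
    using d by (simp flip: power_add power_Suc)
  also have "\<dots> \<le> (4 * d * E) * D ^ (d - 1) * D ^ (N - d)"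
    using q D by (intro mult_right_mono) (auto simp: D_def intro!: mult_right_mono)
  also have "\<dots> = (8 * d * E) * D ^ (d - 1) * (1 / 2) * D ^ (N - d)" by simp
  also have "\<dots> \<le> (8 * d * E) * D ^ (d - 1) * (1 + (- 1 / q)) ^ (d - 1) * D ^ (N - d)"
    using B D by (intro mult_right_mono mult_left_mono) auto
  also have "\<dots> = 8 * d * (E * (D - E) ^ (d - 1) * D ^ (N - d))"
    by (simp add: DE power_mult_distrib)
  finally have "D ^ N \<le> 8 * d * (E * (D - E) ^ (d - 1) * D ^ (N - d))" .
  moreover have "real (2 ^ k * E - E) = D - E"
    by (subst of_nat_diff) (auto simp: D_def q_def)
  ultimately have "real ((2 ^ k * E) ^ N) \<le> real (8 * d * (E * (2 ^ k * E - E) ^ (d - 1) * (2 ^ k * E) ^ (N - d)))"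
    by (simp add: D_def q_def)
  then show ?thesis by (simp only: of_nat_le_iff)
qed

text \<open>
  A single random density serves only sets \<open>T\<close> of one size. So the points are pairs of a scale \<open>k < K\<close> and a
  function \<open>\<phi>\<close> from \<open>S\<close> to \<open>{..<2\<^sup>K}\<close>, and \<open>(k, \<phi>)\<close> belongs to the set of \<open>s\<close> if \<open>\<phi> s < 2\<^bsup>K-k\<^esup>\<close>, which has
  probability \<open>2\<^bsup>-k\<^esup>\<close>. A set \<open>T\<close> uses the scale with \<open>2\<^sup>k\<close> comparable to its size. The loss
  of a factor \<open>K\<close> is only logarithmic in the size of \<open>S\<close>.
\<close>

theorem isolating_family:
  assumes S: "finite S" "S \<noteq> {}" "4 * card S \<le> 2 ^ K"
  shows "\<exists>m > 0. \<exists>Y :: 's \<Rightarrow> nat set. (\<forall>s\<in>S. Y s \<subseteq> {..<m}) \<and>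
    (\<forall>T\<subseteq>S. \<forall>s\<in>T. m \<le> 8 * K * card T * card (Y s - (\<Union>t\<in>T - {s}. Y t)))"
proof -
  define N where "N = card S"
  define D :: nat where "D = 2 ^ K"
  define X where "X = {..<K} \<times> (\<Pi>\<^sub>E s\<in>S. {..<D})"
  define Z where "Z s = {x \<in> X. snd x s < 2 ^ (K - fst x)}" for s
  have N: "1 \<le> N" "4 * N \<le> 2 ^ K" using S by (auto simp: N_def Suc_le_eq card_gt_0_iff)
  have finX: "finite X" unfolding X_def using S(1) by (intro finite_cartesian_product finite_PiE) auto
  have cardX: "card X = K * D ^ N"
    using S(1) by (simp add: X_def card_cartesian_product card_PiE N_def)
  have K: "K > 0" using N by (cases K) auto
  have isolated: "card X \<le> 8 * K * card T * card (Z s - (\<Union>t\<in>T - {s}. Z t))" if T: "T \<subseteq> S" "s \<in> T" for T s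
  proof -
    have finT: "finite T" using T(1) S(1) by (rule finite_subset)
    have d: "1 \<le> card T" "card T \<le> N"
      using T finT S(1) by (auto simp: N_def Suc_le_eq card_gt_0_iff intro: card_mono)
    obtain k where k: "2 * card T \<le> 2 ^ k" "2 ^ k < 4 * card T" using dyadic_scale[OF d(1)] .
    have "(2::nat) ^ k < 2 ^ K" using k(2) d(2) N(2) by linarith
    then have kK: "k < K" by simp
    define E :: nat where "E = 2 ^ (K - k)"
    have DE: "D = 2 ^ k * E" using kK by (simp add: D_def E_def flip: power_add)
    define R where "R u = (if u = s then {..<E} else if u \<in> T then {E..<D} else {..<D})" for u
    have R: "R u \<subseteq> {..<D}" for u by (auto simp: R_def DE intro: less_le_trans)
    have "card (Pi\<^sub>E S R) = (\<Prod>u\<in>S. card (R u))" by (rule card_PiE[OF S(1)])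
    also have "\<dots> = (\<Prod>u\<in>S - T. card (R u)) * (\<Prod>u\<in>T. card (R u))"
      by (rule prod.subset_diff[OF T(1) S(1)])
    also have "(\<Prod>u\<in>T. card (R u)) = card (R s) * (\<Prod>u\<in>T - {s}. card (R u))"
      by (rule prod.remove[OF finT T(2)])
    also have "(\<Prod>u\<in>T - {s}. card (R u)) = (\<Prod>u\<in>T - {s}. D - E)"
      by (intro prod.cong refl) (auto simp: R_def)
    also have "(\<Prod>u\<in>S - T. card (R u)) = (\<Prod>u\<in>S - T. D)"
      using T(2) by (intro prod.cong refl) (auto simp: R_def)
    also have "card (R s) = E" by (simp add: R_def)
    finally have cardR: "card (Pi\<^sub>E S R) = E * (D - E) ^ (card T - 1) * D ^ (N - card T)"
      using T finT by (simp add: N_def card_Diff_subset ac_simps)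
    have sub: "{k} \<times> Pi\<^sub>E S R \<subseteq> Z s - (\<Union>t\<in>T - {s}. Z t)"
    proof
      fix x assume "x \<in> {k} \<times> Pi\<^sub>E S R"
      then obtain \<phi> where x: "x = (k, \<phi>)" and \<phi>: "\<phi> \<in> Pi\<^sub>E S R" by blast
      have xX: "x \<in> X" using x \<phi> R kK by (auto simp: X_def PiE_iff)
      have "\<phi> s \<in> R s" "\<And>t. t \<in> T - {s} \<Longrightarrow> \<phi> t \<in> R t" using \<phi> T by (auto simp: PiE_iff)
      then have "\<phi> s < E" "\<And>t. t \<in> T - {s} \<Longrightarrow> E \<le> \<phi> t" by (auto simp: R_def)
      then show "x \<in> Z s - (\<Union>t\<in>T - {s}. Z t)" using xX by (auto simp: Z_def x E_def not_less)
    qed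
    have "finite (Z s - (\<Union>t\<in>T - {s}. Z t))" using finX by (simp add: Z_def)
    then have "card ({k} \<times> Pi\<^sub>E S R) \<le> card (Z s - (\<Union>t\<in>T - {s}. Z t))" using sub by (rule card_mono)
    then have "E * (D - E) ^ (card T - 1) * D ^ (N - card T) \<le> card (Z s - (\<Union>t\<in>T - {s}. Z t))"
      by (simp add: card_cartesian_product cardR)
    then have "8 * card T * (E * (D - E) ^ (card T - 1) * D ^ (N - card T)) \<le> 8 * card T * card (Z s - (\<Union>t\<in>T - {s}. Z t))"
      by (rule mult_le_mono2)
    with isolation_count[OF d k, of E] have "D ^ N \<le> 8 * card T * card (Z s - (\<Union>t\<in>T - {s}. Z t))"
      by (simp only: DE[symmetric])
    then have "K * D ^ N \<le> K * (8 * card T * card (Z s - (\<Union>t\<in>T - {s}. Z t)))" by (rule mult_le_mono2)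
    then show ?thesis by (simp only: cardX ac_simps)
  qed
  obtain h where h: "bij_betw h X {0..<card X}" using ex_bij_betw_finite_nat[OF finX] by blast
  then have inj: "inj_on h X" by (rule bij_betw_imp_inj_on)
  have ZX: "Z s \<subseteq> X" for s by (auto simp: Z_def)
  have img: "h ` Z s - (\<Union>t\<in>T - {s}. h ` Z t) = h ` (Z s - (\<Union>t\<in>T - {s}. Z t))" for T s
  proof -
    have "h ` (Z s - (\<Union>t\<in>T - {s}. Z t)) = h ` Z s - h ` (\<Union>t\<in>T - {s}. Z t)"
      using ZX by (intro inj_on_image_set_diff[OF inj]) blast+
    then show ?thesis by (simp add: image_UN)
  qed
  have card_img: "card (h ` (Z s - B)) = card (Z s - B)" for s B
    using ZX by (intro card_image inj_on_subset[OF inj]) blast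
  show ?thesis
  proof (intro exI[of _ "card X"] conjI exI[of _ "\<lambda>s. h ` Z s"] ballI allI impI)
    show "0 < card X" using K by (simp add: cardX D_def)
    show "h ` Z s \<subseteq> {..<card X}" for s
      using ZX[of s] bij_betw_imp_surj_on[OF h] by (auto simp: lessThan_atLeast0)
    show "card X \<le> 8 * K * card T * card (h ` Z s - (\<Union>t\<in>T - {s}. h ` Z t))" if "T \<subseteq> S" "s \<in> T" for T s
      unfolding img card_img by (rule isolated[OF that])
  qed
qed

section \<open>Expanding groups violate the strong rank condition\<close>

lemma set_mult_image: "F <#>\<^bsub>G\<^esub> S = (\<lambda>(g, s). g \<otimes>\<^bsub>G\<^esub> s) ` (F \<times> S)"
  by (auto simp: set_mult_def)

text \<open>
  Give \<open>(g, s)\<close> the weight \<open>1 / d\<close>, where \<open>d\<close> is the number of pairs with the same product. The weights over one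
  product add up to \<open>1\<close>, so all of them add up to \<open>\<bar>F S\<bar>\<close>, and some \<open>g\<close> gets more than \<open>c\<close>.
\<close>

lemma (in group) expansion_pigeonhole:
  fixes w :: "'a \<Rightarrow> 'a \<Rightarrow> nat" and c m :: nat
  assumes F: "finite F" "F \<subseteq> carrier G" and S: "finite S" "S \<subseteq> carrier G"
    and expanding: "c * card F < card (F <#> S)" and m: "m > 0"
    and w: "\<And>g s. \<lbrakk>g \<in> F; s \<in> S\<rbrakk> \<Longrightarrow> m \<le> c * card {t \<in> S. \<exists>g'\<in>F. g' \<otimes> t = g \<otimes> s} * w g s"
  shows "\<exists>g\<in>F. m < (\<Sum>s\<in>S. w g s)"
proof (rule ccontr)
  assume neg: "\<not> ?thesis"
  define T where "T h = {t \<in> S. \<exists>g\<in>F. g \<otimes> t = h}" for h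
  define pr where "pr = (\<lambda>(g, s). g \<otimes> s)"
  have finFS: "finite (F \<times> S)" using F S by simp
  have FS: "F <#> S = pr ` (F \<times> S)" unfolding pr_def by (rule set_mult_image)
  have fibre: "card {x \<in> F \<times> S. pr x = h} = card (T h)" for h
  proof (rule bij_betw_same_card)
    show "bij_betw snd {x \<in> F \<times> S. pr x = h} (T h)"
      unfolding bij_betw_def
    proof
      show "inj_on snd {x \<in> F \<times> S. pr x = h}"
      proof (rule inj_onI)
        fix x y assume xy: "x \<in> {x \<in> F \<times> S. pr x = h}" "y \<in> {x \<in> F \<times> S. pr x = h}" "snd x = snd y"
        then have "fst x \<otimes> snd x = fst y \<otimes> snd x" "fst x \<in> carrier G" "fst y \<in> carrier G" "snd x \<in> carrier G"
          using F(2) S(2) by (auto simp: pr_def)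
        then have "fst x = fst y" by simp
        then show "x = y" using xy(3) by (rule prod_eqI)
      qed
      show "snd ` {x \<in> F \<times> S. pr x = h} = T h"
        by (force simp: pr_def T_def image_iff)
    qed
  qed
  have "(\<Sum>x\<in>F \<times> S. 1 / real (card (T (pr x))))
      = (\<Sum>h\<in>F <#> S. \<Sum>x\<in>{x \<in> F \<times> S. pr x = h}. 1 / real (card (T (pr x))))"
    unfolding FS by (rule sum.image_gen[OF finFS])
  also have "\<dots> = (\<Sum>h\<in>F <#> S. 1)"
  proof (rule sum.cong[OF refl])
    fix h assume "h \<in> F <#> S"
    then have "T h \<noteq> {}" by (auto simp: FS pr_def T_def)
    moreover have "finite (T h)" using S by (simp add: T_def)
    ultimately have "card (T h) \<noteq> 0" by simp
    then show "(\<Sum>x\<in>{x \<in> F \<times> S. pr x = h}. 1 / real (card (T (pr x)))) = 1"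
      using fibre[of h] by simp
  qed
  finally have total: "(\<Sum>x\<in>F \<times> S. 1 / real (card (T (pr x)))) = card (F <#> S)" by simp
  have "real m * card (F <#> S) = (\<Sum>x\<in>F \<times> S. real m / real (card (T (pr x))))"
    unfolding total[symmetric] sum_distrib_left by simp
  also have "\<dots> \<le> (\<Sum>x\<in>F \<times> S. real c * real (w (fst x) (snd x)))"
  proof (rule sum_mono)
    fix x assume x: "x \<in> F \<times> S"
    then have "m \<le> c * card (T (pr x)) * w (fst x) (snd x)"
      using w[of "fst x" "snd x"] by (auto simp: T_def pr_def)
    then have le: "real m \<le> real c * card (T (pr x)) * w (fst x) (snd x)"
      by (metis of_nat_le_iff of_nat_mult)
    then have "card (T (pr x)) \<noteq> 0" using m by (intro notI) simp
    then show "real m / real (card (T (pr x))) \<le> real c * real (w (fst x) (snd x))"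
      using le by (simp add: field_simps)
  qed
  also have "\<dots> = (\<Sum>g\<in>F. real c * real (\<Sum>s\<in>S. w g s))"
    by (simp add: sum.cartesian_product' sum_distrib_left)
  also have "\<dots> \<le> (\<Sum>g\<in>F. real c * real m)"
  proof (rule sum_mono)
    fix g assume "g \<in> F"
    then have "(\<Sum>s\<in>S. w g s) \<le> m" using neg by (auto simp: not_less)
    then show "real c * real (\<Sum>s\<in>S. w g s) \<le> real c * real m"
      by (intro mult_left_mono) (simp_all only: of_nat_le_iff of_nat_0_le_iff)
  qed
  also have "\<dots> = real m * real (c * card F)" by simp
  finally have "real (card (F <#> S)) \<le> real (c * card F)" using m by simp
  then have "card (F <#> S) \<le> c * card F" by (simp only: of_nat_le_iff)
  with expanding show False by simp
qed

text \<open>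
  The matrix of the map has entries \<open>\<Sum> t\<^bsub>s,i\<^esub>\<^sup>j s\<close>, the sum over the \<open>s\<close> with \<open>i \<in> Y s\<close>. The numbers
  \<open>t\<^bsub>s,i\<^esub>\<close> being distinct, any \<open>m + 1\<close> of the evaluation functionals on polynomials of degree at most \<open>m\<close> are linearly
  independent. It is therefore enough that some point of the support sees more than \<open>m\<close> evaluations undisturbed.
\<close>

theorem expanding_imp_injective:
  fixes G :: "('a, 'b) monoid_scheme" (structure)
  assumes G: "group G" and S: "finite S" "S \<subseteq> carrier G" "S \<noteq> {}" "4 * card S \<le> 2 ^ K"
    and expanding: "\<forall>F. finite F \<longrightarrow> F \<noteq> {} \<longrightarrow> F \<subseteq> carrier G \<longrightarrow> 8 * K * card F < card (F <#> S)"
  shows "\<exists>m (\<alpha> :: ('a \<times> nat \<Rightarrow>\<^sub>0 int) \<Rightarrow> ('a \<times> nat \<Rightarrow>\<^sub>0 int)). (\<forall>x y. \<alpha> (x - y) = \<alpha> x - \<alpha> y) \<and>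
    (\<forall>g\<in>carrier G. \<forall>x. Poly_Mapping.keys x \<subseteq> carrier G \<times> {..m} \<longrightarrow>
      \<alpha> (G_set.translate (free_act G) g x) = G_set.translate (free_act G) g (\<alpha> x)) \<and>
    (\<forall>x. Poly_Mapping.keys x \<subseteq> carrier G \<times> {..m} \<longrightarrow> Poly_Mapping.keys (\<alpha> x) \<subseteq> carrier G \<times> {..<m}) \<and>
    (\<forall>x. Poly_Mapping.keys x \<subseteq> carrier G \<times> {..m} \<longrightarrow> \<alpha> x = 0 \<longrightarrow> x = 0)"
proof -
  interpret group G by fact
  obtain m and Y :: "'a \<Rightarrow> nat set" where m: "m > 0" and Y': "\<forall>s\<in>S. Y s \<subseteq> {..<m}"
    and isolated': "\<forall>T\<subseteq>S. \<forall>s\<in>T. m \<le> 8 * K * card T * card (Y s - (\<Union>t\<in>T - {s}. Y t))"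
    using isolating_family[OF S(1,3,4)] by (elim exE conjE)
  have Y: "Y s \<subseteq> {..<m}" if "s \<in> S" for s using Y' that by blast
  have isolated: "m \<le> 8 * K * card T * card (Y s - (\<Union>t\<in>T - {s}. Y t))" if "T \<subseteq> S" "s \<in> T" for T s
    using isolated' that by blast
  interpret G_set G "free_act G" "carrier G \<times> {..m}" by (rule G_set_free_act[OF G])
  obtain \<iota> :: "'a \<Rightarrow> nat" where \<iota>: "inj_on \<iota> S" using finite_imp_inj_to_nat_seg[OF S(1)] by blast
  define t where "t s i = int (prod_encode (\<iota> s, i))" for s i
  have t_inj: "s = s' \<and> i = i'" if "t s i = t s' i'" "s \<in> S" "s' \<in> S" for s s' i i'
    using that inj_onD[OF \<iota>] by (auto simp: t_def)
  have finY: "finite (Y s)" if "s \<in> S" for s using Y[OF that] finite_subset by blast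
  define \<beta> where "\<beta> p = (\<Sum>s\<in>S. \<Sum>i\<in>Y s. frag_cmul (t s i ^ snd p) (frag_of (fst p \<otimes> s, i)))" for p :: "'a \<times> nat"
  define \<alpha> where "\<alpha> = frag_extend \<beta>"
  have lookup_\<beta>: "Poly_Mapping.lookup (\<beta> p) (h, i) = (\<Sum>s\<in>S. if fst p \<otimes> s = h \<and> i \<in> Y s then t s i ^ snd p else 0)" for p h i
  proof -
    have "Poly_Mapping.lookup (\<beta> p) (h, i) = (\<Sum>s\<in>S. \<Sum>i'\<in>Y s. if i = i' then (if fst p \<otimes> s = h then t s i ^ snd p else 0) else 0)"
      unfolding \<beta>_def lookup_sum by (intro sum.cong refl) auto
    also have "\<dots> = (\<Sum>s\<in>S. if fst p \<otimes> s = h \<and> i \<in> Y s then t s i ^ snd p else 0)"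
      by (intro sum.cong refl) (auto simp: sum.delta finY)
    finally show ?thesis .
  qed
  have keys: "Poly_Mapping.keys (\<alpha> x) \<subseteq> carrier G \<times> {..<m}" if x: "Poly_Mapping.keys x \<subseteq> carrier G \<times> {..m}" for x
  proof -
    have "Poly_Mapping.keys (\<beta> p) \<subseteq> carrier G \<times> {..<m}" if p: "p \<in> carrier G \<times> {..m}" for p
    proof
      fix z assume z: "z \<in> Poly_Mapping.keys (\<beta> p)"
      obtain h i where hi: "z = (h, i)" by (cases z)
      have "(\<Sum>s\<in>S. if fst p \<otimes> s = h \<and> i \<in> Y s then t s i ^ snd p else 0) \<noteq> 0"
        using z by (simp add: hi in_keys_iff lookup_\<beta>)
      then obtain s where s: "s \<in> S" "(if fst p \<otimes> s = h \<and> i \<in> Y s then t s i ^ snd p else 0) \<noteq> 0"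
        by (rule sum.not_neutral_contains_not_neutral)
      then have "fst p \<otimes> s = h \<and> i \<in> Y s" by (meson)
      then show "z \<in> carrier G \<times> {..<m}" using p S(2) Y[OF s(1)] s(1) by (auto simp: hi)
    qed
    then show ?thesis unfolding \<alpha>_def using x by (intro order_trans[OF keys_frag_extend] UN_least) blast
  qed
  have equivariant: "\<alpha> (translate g x) = translate g (\<alpha> x)"
    if g: "g \<in> carrier G" and x: "Poly_Mapping.keys x \<subseteq> carrier G \<times> {..m}" for g x
    using x
  proof (induction x rule: frag_induction)
    case (one p)
    have "translate g (\<Sum>i\<in>I. f i) = (\<Sum>i\<in>I. translate g (f i))" for I :: "'z set" and f
      by (induction I rule: infinite_finite_induct) simp_all
    note translate_sum = this
    have translate_frag_of: "translate g (frag_of q) = frag_of (g \<otimes> fst q, snd q)" for q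
      by (simp only: translate_simps(2) free_act_def)
    have "g \<otimes> fst p \<otimes> s = g \<otimes> (fst p \<otimes> s)" if "s \<in> S" for s
      using one g S(2) that by (intro m_assoc) auto
    then show ?case
      by (simp add: \<alpha>_def \<beta>_def translate_sum translate_frag_of del: translate_simps(2))
  qed (simp_all add: \<alpha>_def frag_extend_diff)
  have inj: "x = 0" if x: "Poly_Mapping.keys x \<subseteq> carrier G \<times> {..m}" and 0: "\<alpha> x = 0" for x
  proof (rule ccontr)
    assume "x \<noteq> 0"
    define F where "F = fst ` Poly_Mapping.keys x"
    have F: "finite F" "F \<noteq> {}" "F \<subseteq> carrier G" using x \<open>x \<noteq> 0\<close> by (auto simp: F_def)
    \<comment> \<open>\<open>P g s\<close> consists of the coordinates \<open>i\<close> at which \<open>g\<close> is the only support point contributing to \<open>(g s, i)\<close>.\<close>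
    define T where "T h = {s \<in> S. \<exists>g\<in>F. g \<otimes> s = h}" for h
    define P where "P g s = Y s - (\<Union>r\<in>T (g \<otimes> s) - {s}. Y r)" for g s
    have "\<exists>g\<in>F. m < (\<Sum>s\<in>S. card (P g s))"
    proof (rule expansion_pigeonhole[OF F(1,3) S(1,2) expanding[rule_format, OF F] m])
      fix g s assume "g \<in> F" "s \<in> S"
      then show "m \<le> 8 * K * card {r \<in> S. \<exists>g'\<in>F. g' \<otimes> r = g \<otimes> s} * card (P g s)"
        unfolding P_def T_def by (intro isolated) auto
    qed
    then obtain g where g: "g \<in> F" "m < (\<Sum>s\<in>S. card (P g s))" by blast
    have gG: "g \<in> carrier G" using g F by blast
    define q where "q = (\<Sum>j\<le>m. monom (Poly_Mapping.lookup x (g, j)) j)"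
    have q_coeff: "coeff q j = Poly_Mapping.lookup x (g, j)" if "j \<le> m" for j
      using that by (simp add: q_def coeff_sum sum.delta)
    obtain j where j: "(g, j) \<in> Poly_Mapping.keys x" using g(1) by (auto simp: F_def)
    then have "coeff q j \<noteq> 0" using x by (subst q_coeff) (auto simp: in_keys_iff)
    then have "q \<noteq> 0" by auto
    have deg: "degree q \<le> m"
      unfolding q_def by (intro degree_sum_le) (auto intro: order_trans[OF degree_monom_le])
    have root: "poly q (t s i) = 0" if s: "s \<in> S" and i: "i \<in> P g s" for s i
    proof -
      have only: "(\<Sum>s'\<in>S. if fst p \<otimes> s' = g \<otimes> s \<and> i \<in> Y s' then t s' i ^ snd p else 0) = (if fst p = g then t s i ^ snd p else 0)"
        if p: "p \<in> Poly_Mapping.keys x" for p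
      proof -
        have pF: "fst p \<in> F" "fst p \<in> carrier G" using p F by (auto simp: F_def)
        have "fst p \<otimes> s' = g \<otimes> s \<and> i \<in> Y s' \<longleftrightarrow> s' = s \<and> fst p = g" if s': "s' \<in> S" for s'
        proof
          assume *: "fst p \<otimes> s' = g \<otimes> s \<and> i \<in> Y s'"
          then have "s' \<in> T (g \<otimes> s)" using s' pF by (auto simp: T_def)
          then have "s' = s" using * i by (auto simp: P_def)
          then show "s' = s \<and> fst p = g" using * pF gG s S(2) by auto
        next
          assume "s' = s \<and> fst p = g"
          then show "fst p \<otimes> s' = g \<otimes> s \<and> i \<in> Y s'" using i by (auto simp: P_def)
        qed
        then have "(\<Sum>s'\<in>S. if fst p \<otimes> s' = g \<otimes> s \<and> i \<in> Y s' then t s' i ^ snd p else 0)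
          = (\<Sum>s'\<in>S. if s' = s then (if fst p = g then t s i ^ snd p else 0) else 0)"
          by (intro sum.cong refl) auto
        then show ?thesis using s S(1) by (simp add: sum.delta)
      qed
      have "0 = Poly_Mapping.lookup (\<alpha> x) (g \<otimes> s, i)" by (simp add: 0)
      also have "\<dots> = (\<Sum>p\<in>Poly_Mapping.keys x. Poly_Mapping.lookup x p * (if fst p = g then t s i ^ snd p else 0))"
        unfolding \<alpha>_def frag_extend_def lookup_sum lookup_frag_cmul
        by (intro sum.cong refl) (auto simp: only lookup_\<beta>)
      also have "\<dots> = (\<Sum>p\<in>{g} \<times> {..m}. Poly_Mapping.lookup x p * t s i ^ snd p)"
        using x by (intro sum.mono_neutral_cong) (auto simp: in_keys_iff)
      also have "\<dots> = poly q (t s i)"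
        by (simp add: sum.cartesian_product' q_def poly_sum poly_monom)
      finally show ?thesis by simp
    qed
    define R where "R = (\<lambda>(s, i). t s i) ` (SIGMA s:S. P g s)"
    have R_inj: "inj_on (\<lambda>(s, i). t s i) (SIGMA s:S. P g s)"
      by (rule inj_onI) (auto dest: t_inj)
    have "finite (P g s)" if "s \<in> S" for s using finY[OF that] by (simp add: P_def)
    then have "card R = (\<Sum>s\<in>S. card (P g s))"
      unfolding R_def card_image[OF R_inj] using S(1) by (intro card_SigmaI) auto
    moreover have "R \<subseteq> {z. poly q z = 0}" using root by (auto simp: R_def)
    then have "card R \<le> card {z. poly q z = 0}" by (intro card_mono poly_roots_finite \<open>q \<noteq> 0\<close>)
    moreover have "card {z. poly q z = 0} \<le> degree q" by (rule card_poly_roots_bound[OF \<open>q \<noteq> 0\<close>])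
    ultimately show False using g(2) deg by linarith
  qed
  have "\<alpha> (x - y) = \<alpha> x - \<alpha> y" for x y by (simp add: \<alpha>_def frag_extend_diff)
  with keys equivariant inj show ?thesis by blast
qed

section \<open>Amenability\<close>

lemma exponential_beats_linear:
  fixes \<epsilon> :: real
  assumes "\<epsilon> > 0"
  shows "\<exists>r::nat. 8 * (real b * real r + 2) < (1 + \<epsilon>) ^ r"
proof -
  define x where "x = 1 / (1 + \<epsilon>)"
  have x: "0 < x" "x < 1" using assms by (simp_all add: x_def)
  have "(\<lambda>r. real r * x ^ r) \<longlonglongrightarrow> 0" using x by (intro powser_times_n_limit_0) simp
  then have "\<forall>\<^sub>F r in sequentially. real r * x ^ r < 1 / (8 * (real b + 2))"
    by (rule order_tendstoD) simp
  then have "\<forall>\<^sub>F r in sequentially. r \<ge> 1 \<and> real r * x ^ r < 1 / (8 * (real b + 2))"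
    using eventually_ge_at_top[of 1] by eventually_elim simp
  then obtain r where r: "r \<ge> 1" "real r * x ^ r < 1 / (8 * (real b + 2))"
    by (auto simp: eventually_at_top_linorder)
  have "8 * (real b * real r + 2) \<le> 8 * (real b + 2) * real r" using r(1) by (simp add: algebra_simps)
  also have "\<dots> < (1 + \<epsilon>) ^ r"
    using r(2) assms by (simp add: x_def power_one_over field_simps)
  finally show ?thesis by blast
qed

text \<open>
  Powers \<open>S\<^sup>r\<close> improve the expansion to \<open>(1 + \<epsilon>)\<^sup>r\<close>, whereas \<open>\<bar>S\<^sup>r\<bar> \<le> \<bar>S\<bar>\<^sup>r\<close>, so the required factor
  \<open>8 K\<close> grows only linearly in \<open>r\<close>.
\<close>

lemma (in group) expanding_power:
  fixes \<epsilon> :: real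
  assumes S: "finite S" "S \<subseteq> carrier G" "S \<noteq> {}" and \<epsilon>: "\<epsilon> > 0"
    and expanding: "\<And>F. \<lbrakk>finite F; F \<noteq> {}; F \<subseteq> carrier G\<rbrakk> \<Longrightarrow> (1 + \<epsilon>) * card F \<le> card (F <#> S)"
  shows "\<exists>T K. finite T \<and> T \<subseteq> carrier G \<and> T \<noteq> {} \<and> 4 * card T \<le> 2 ^ K \<and>
    (\<forall>F. finite F \<longrightarrow> F \<noteq> {} \<longrightarrow> F \<subseteq> carrier G \<longrightarrow> 8 * K * card F < card (F <#> T))"
proof -
  define P where "P r = ((\<lambda>T. T <#> S) ^^ r) {\<one>}" for r
  have P0: "P 0 = {\<one>}" and PS: "P (Suc r) = P r <#> S" for r by (simp_all add: P_def)
  have P: "finite (P r) \<and> P r \<subseteq> carrier G \<and> P r \<noteq> {} \<and> card (P r) \<le> card S ^ r" for r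
  proof (induction r)
    case (Suc r)
    have "card (P (Suc r)) \<le> card (P r \<times> S)"
      unfolding PS set_mult_image using Suc S(1) by (intro card_image_le) simp
    also have "\<dots> \<le> card S ^ Suc r" using Suc by (simp add: card_cartesian_product)
    finally show ?case
      using Suc S unfolding PS by (auto simp: set_mult_image subset_iff)
  qed (simp add: P0)
  have growth: "(1 + \<epsilon>) ^ r * card F \<le> card (F <#> P r)" if F: "finite F" "F \<noteq> {}" "F \<subseteq> carrier G" for F r
  proof (induction r)
    case 0
    have "F <#> P 0 = F" using F(3) by (force simp: P0 set_mult_def)
    then show ?case by simp
  next
    case (Suc r)
    have fin: "finite (F <#> P r)" "F <#> P r \<noteq> {}" "F <#> P r \<subseteq> carrier G"
      using F P[of r] set_mult_closed[of F "P r"] by (auto simp: set_mult_image)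
    have "(1 + \<epsilon>) ^ Suc r * card F \<le> (1 + \<epsilon>) * card (F <#> P r)"
      using Suc \<epsilon> by (simp add: mult.assoc mult_left_mono)
    also have "\<dots> \<le> card ((F <#> P r) <#> S)" by (rule expanding[OF fin])
    also have "(F <#> P r) <#> S = F <#> P (Suc r)"
      unfolding PS using F P S by (intro set_mult_assoc) auto
    finally show ?case .
  qed
  define b where "b = card S"
  obtain r where r: "8 * (real b * real r + 2) < (1 + \<epsilon>) ^ r" using exponential_beats_linear[OF \<epsilon>] by blast
  have "4 * card (P r) \<le> 2 ^ (b * r + 2)"
  proof -
    have "card (P r) \<le> b ^ r" using P[of r] by (simp add: b_def)
    also have "\<dots> \<le> (2 ^ b) ^ r" by (rule power_mono[OF less_imp_le[OF less_exp]]) simp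
    finally show ?thesis by (simp add: power_mult)
  qed
  moreover have "8 * (b * r + 2) * card F < card (F <#> P r)" if F: "finite F" "F \<noteq> {}" "F \<subseteq> carrier G" for F
  proof -
    have "real (8 * (b * r + 2) * card F) = 8 * (real b * real r + 2) * card F" by simp
    also have "\<dots> < (1 + \<epsilon>) ^ r * card F"
      using F r by (intro mult_strict_right_mono) (auto simp: card_gt_0_iff)
    also have "\<dots> \<le> card (F <#> P r)" by (rule growth[OF F])
    finally show ?thesis by (simp only: of_nat_less_iff)
  qed
  ultimately show ?thesis using P[of r] by (intro exI[of _ "P r"] exI[of _ "b * r + 2"]) simp
qed

lemma (in group) not_folner_imp_expanding:
  fixes \<epsilon> :: real
  assumes S: "finite S" "S \<subseteq> carrier G"
    and nf: "\<And>F. \<lbrakk>finite F; F \<noteq> {}; F \<subseteq> carrier G\<rbrakk> \<Longrightarrow> \<exists>s\<in>S. \<epsilon> * card F < card ((F #> s) - F)"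
    and F: "finite F" "F \<noteq> {}" "F \<subseteq> carrier G"
  shows "(1 + \<epsilon>) * card F \<le> card (F <#> insert \<one> S)"
proof -
  obtain s where s: "s \<in> S" "\<epsilon> * card F < card ((F #> s) - F)" using nf[OF F] by blast
  have fin: "finite (F #> s)" "finite (F <#> insert \<one> S)"
    using F S by (auto simp: r_coset_def set_mult_image)
  have "F \<subseteq> F <#> insert \<one> S" using F(3) by (force simp: set_mult_def)
  moreover have "F #> s \<subseteq> F <#> insert \<one> S" using s(1) by (auto simp: r_coset_def set_mult_def)
  ultimately have "card (F \<union> ((F #> s) - F)) \<le> card (F <#> insert \<one> S)"
    using fin by (intro card_mono) auto
  moreover have "card (F \<union> ((F #> s) - F)) = card F + card ((F #> s) - F)"
    using F fin by (intro card_Un_disjoint) auto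
  ultimately show ?thesis using s(2) by (simp add: algebra_simps)
qed

text \<open>
  Folner sets are taken to be almost invariant under right multiplication and the mean has to be invariant under left
  multiplication, so points are counted by their inverses.
\<close>

lemma (in group) folner_almost_invariant:
  assumes F: "finite F" "F \<subseteq> carrier G" and g: "g \<in> carrier G" and A: "A \<subseteq> carrier G"
  shows "\<bar>real (card {x\<in>F. inv x \<in> g <# A}) - real (card {x\<in>F. inv x \<in> A})\<bar> \<le> card ((F #> g) - F)"
proof -
  have Fg: "F #> g = (\<lambda>x. x \<otimes> g) ` F" by (auto simp: r_coset_def)
  have inj: "inj_on (\<lambda>x. x \<otimes> g) F" by (meson F(2) g inj_onI right_cancel subsetD)
  define B where "B = {y \<in> F #> g. inv y \<in> A}"
  define C where "C = {x \<in> F. inv x \<in> A}"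
  have mem: "inv x \<in> g <# A \<longleftrightarrow> inv (x \<otimes> g) \<in> A" if x: "x \<in> F" for x
  proof -
    have xG: "x \<in> carrier G" using x F(2) by blast
    have "inv x = g \<otimes> a \<longleftrightarrow> inv (x \<otimes> g) = a" if "a \<in> A" for a
      using inv_solve_left[of a g "inv x"] xG g A that by (auto simp: inv_mult_group)
    then show ?thesis by (auto simp: l_coset_def)
  qed
  have "B = (\<lambda>x. x \<otimes> g) ` {x \<in> F. inv x \<in> g <# A}" unfolding B_def Fg using mem by auto
  then have cB: "card {x \<in> F. inv x \<in> g <# A} = card B"
    using card_image[OF inj_on_subset[OF inj]] by (metis (no_types, lifting) mem_Collect_eq subsetI)
  have fin: "finite (F #> g)" using F by (simp add: Fg)
  have eq: "card (F - (F #> g)) = card ((F #> g) - F)"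
  proof -
    have "card (F #> g) = card F" unfolding Fg by (rule card_image[OF inj])
    moreover have "card (F #> g) = card ((F #> g) \<inter> F) + card ((F #> g) - F)"
      using fin by (rule card_Int_Diff)
    moreover have "card F = card (F \<inter> (F #> g)) + card (F - (F #> g))"
      using F(1) by (rule card_Int_Diff)
    ultimately show ?thesis by (simp add: Int_commute)
  qed
  have "card B \<le> card (C \<union> ((F #> g) - F))"
    using F fin by (intro card_mono) (auto simp: B_def C_def)
  also have "\<dots> \<le> card C + card ((F #> g) - F)" by (rule card_Un_le)
  finally have 1: "card B \<le> card C + card ((F #> g) - F)" .
  have "card C \<le> card (B \<union> (F - (F #> g)))"
    using F fin by (intro card_mono) (auto simp: B_def C_def)
  also have "\<dots> \<le> card B + card (F - (F #> g))" by (rule card_Un_le)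
  finally have 2: "card C \<le> card B + card ((F #> g) - F)" by (simp add: eq)
  show ?thesis using 1 2 unfolding cB C_def[symmetric] by linarith
qed

text \<open>
  The normalised counting functions of Folner sets lie in the product of one copy of \<open>[0, 1]\<close> for each set, a compact space.
  Finite additivity, and invariance under \<open>g\<close> up to \<open>1 / (n + 1)\<close>, are closed conditions, any finitely many of which are met by
  one Folner set. By compactness they have a common solution.
\<close>

theorem folner_imp_amenable:
  fixes G :: "('a, 'b) monoid_scheme" (structure)
  assumes G: "group G"
    and folner: "\<And>S (\<epsilon>::real). \<lbrakk>finite S; S \<subseteq> carrier G; \<epsilon> > 0\<rbrakk> \<Longrightarrow>
      \<exists>F. finite F \<and> F \<noteq> {} \<and> F \<subseteq> carrier G \<and> (\<forall>s\<in>S. card ((F #> s) - F) \<le> \<epsilon> * card F)"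
  shows "amenable G"
proof -
  interpret group G by fact
  define M :: "('a set \<Rightarrow> real) set" where "M = {\<mu>. \<forall>A. 0 \<le> \<mu> A \<and> \<mu> A \<le> 1}"
  define N :: "('a set \<Rightarrow> real) set" where
    "N = {\<mu>. \<mu> (carrier G) = 1 \<and> (\<forall>A B. A \<inter> B = {} \<longrightarrow> \<mu> (A \<union> B) = \<mu> A + \<mu> B)}"
  define K :: "'a \<times> nat \<Rightarrow> ('a set \<Rightarrow> real) set" where
    "K p = {\<mu>. \<forall>A. A \<subseteq> carrier G \<longrightarrow> \<bar>\<mu> (fst p <# A) - \<mu> A\<bar> \<le> 1 / (real (snd p) + 1)}" for p
  have cont: "continuous_on UNIV (\<lambda>\<mu> :: 'a set \<Rightarrow> real. \<mu> A)" for A by simp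
  have "M = (\<Pi>\<^sub>E A\<in>UNIV. {0..1})" by (auto simp: M_def)
  then have "compact M"
    using compactin_PiE[of "\<lambda>_. euclidean" UNIV "\<lambda>_::'a set. {0..1::real}"]
    by (simp add: euclidean_product_topology)
  moreover have "closed N" unfolding N_def
    by (intro closed_Collect_conj closed_Collect_all closed_Collect_imp closed_Collect_eq
        continuous_intros cont open_Collect_const)
  ultimately have MN: "compact (M \<inter> N)" by (rule compact_Int_closed)
  have K: "closed (K p)" for p unfolding K_def
    by (intro closed_Collect_all closed_Collect_imp closed_Collect_le
        continuous_intros cont open_Collect_const)
  have "(M \<inter> N) \<inter> (\<Inter>p\<in>carrier G \<times> UNIV. K p) \<noteq> {}"
  proof (rule compact_imp_fip_image[OF MN K])
    fix Q :: "('a \<times> nat) set" assume Q: "finite Q" "Q \<subseteq> carrier G \<times> UNIV"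
    define n where "n = Max (insert 0 (snd ` Q))"
    have n: "snd p \<le> n" if "p \<in> Q" for p using that Q(1) by (simp add: n_def)
    have "finite (fst ` Q)" "fst ` Q \<subseteq> carrier G" "1 / (real n + 1) > 0" using Q by auto
    from folner[OF this]
    obtain F where F: "finite F" "F \<noteq> {}" "F \<subseteq> carrier G"
      and inv_F: "\<forall>s\<in>fst ` Q. card ((F #> s) - F) \<le> 1 / (real n + 1) * card F"
      by (elim exE conjE)
    define \<mu> where "\<mu> A = real (card {x\<in>F. inv x \<in> A}) / card F" for A
    have cF: "card F > 0" using F by (simp add: card_gt_0_iff)
    have "\<mu> \<in> M" unfolding M_def \<mu>_def
      using F(1) cF by (auto simp: divide_le_eq_1 intro: card_mono)
    moreover have "\<mu> \<in> N" unfolding N_def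
    proof (intro CollectI conjI allI impI)
      have "{x\<in>F. inv x \<in> carrier G} = F" using F(3) by auto
      then show "\<mu> (carrier G) = 1" using cF by (simp add: \<mu>_def)
      fix A B :: "'a set" assume AB: "A \<inter> B = {}"
      have "{x\<in>F. inv x \<in> A \<union> B} = {x\<in>F. inv x \<in> A} \<union> {x\<in>F. inv x \<in> B}" by auto
      moreover have "card \<dots> = card {x\<in>F. inv x \<in> A} + card {x\<in>F. inv x \<in> B}"
        using F(1) AB by (intro card_Un_disjoint) auto
      ultimately show "\<mu> (A \<union> B) = \<mu> A + \<mu> B" by (simp add: \<mu>_def add_divide_distrib)
    qed
    moreover have "\<mu> \<in> K p" if p: "p \<in> Q" for p unfolding K_def
    proof (intro CollectI allI impI)
      fix A assume A: "A \<subseteq> carrier G"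
      have "fst p \<in> carrier G" using p Q(2) by auto
      then have "\<bar>real (card {x\<in>F. inv x \<in> fst p <# A}) - real (card {x\<in>F. inv x \<in> A})\<bar> \<le> card ((F #> fst p) - F)"
        using folner_almost_invariant[OF F(1,3) _ A] by blast
      also have "\<dots> \<le> 1 / (real n + 1) * card F" using inv_F p by blast
      also have "\<dots> \<le> 1 / (real (snd p) + 1) * card F"
        using n[OF p] by (intro mult_right_mono divide_left_mono) auto
      finally have "\<bar>real (card {x\<in>F. inv x \<in> fst p <# A}) - real (card {x\<in>F. inv x \<in> A})\<bar> / card F \<le> 1 / (real (snd p) + 1)"
        using cF by (subst pos_divide_le_eq) auto
      then show "\<bar>\<mu> (fst p <# A) - \<mu> A\<bar> \<le> 1 / (real (snd p) + 1)"
        using cF by (simp add: \<mu>_def flip: diff_divide_distrib)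
    qed
    ultimately show "(M \<inter> N) \<inter> (\<Inter>p\<in>Q. K p) \<noteq> {}" by blast
  qed
  then obtain \<mu> where \<mu>: "\<mu> \<in> M" "\<mu> \<in> N" and inv: "\<And>p. p \<in> carrier G \<times> UNIV \<Longrightarrow> \<mu> \<in> K p" by blast
  have "\<mu> (g <# A) = \<mu> A" if g: "g \<in> carrier G" and A: "A \<subseteq> carrier G" for g A
  proof (rule ccontr)
    assume "\<mu> (g <# A) \<noteq> \<mu> A"
    then have "\<bar>\<mu> (g <# A) - \<mu> A\<bar> > 0" by simp
    then obtain n :: nat where "inverse (real (Suc n)) < \<bar>\<mu> (g <# A) - \<mu> A\<bar>"
      using reals_Archimedean by blast
    moreover have "\<bar>\<mu> (g <# A) - \<mu> A\<bar> \<le> 1 / (real n + 1)"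
      using inv[of "(g, n)"] g A by (simp add: K_def)
    ultimately show False by (simp add: inverse_eq_divide add.commute)
  qed
  then show ?thesis
    unfolding amenable_def using \<mu> by (intro exI[of _ \<mu>]) (auto simp: M_def N_def)
qed

text \<open>
  Without Folner sets \<open>G\<close> would be expanding and so violate the strong rank condition.
\<close>

theorem hall_imp_amenable:
  fixes G :: "('a, 'b) monoid_scheme" (structure)
  assumes G: "group G" "hall_property G"
  shows "amenable G"
proof (rule folner_imp_amenable[OF G(1)], rule ccontr)
  interpret group G by fact
  fix S and \<epsilon> :: real
  assume S: "finite S" "S \<subseteq> carrier G" and \<epsilon>: "\<epsilon> > 0"
    and neg: "\<not> (\<exists>F. finite F \<and> F \<noteq> {} \<and> F \<subseteq> carrier G \<and> (\<forall>s\<in>S. card ((F #> s) - F) \<le> \<epsilon> * card F))"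
  have "(1 + \<epsilon>) * card F \<le> card (F <#> insert \<one> S)"
    if F: "finite F" "F \<noteq> {}" "F \<subseteq> carrier G" for F
  proof (rule not_folner_imp_expanding[OF S _ F])
    show "\<exists>s\<in>S. \<epsilon> * card E < card ((E #> s) - E)" if "finite E" "E \<noteq> {}" "E \<subseteq> carrier G" for E
      using neg that by (meson not_le)
  qed
  moreover have "finite (insert \<one> S)" "insert \<one> S \<subseteq> carrier G" "insert \<one> S \<noteq> {}" using S by auto
  ultimately have "\<exists>T K. finite T \<and> T \<subseteq> carrier G \<and> T \<noteq> {} \<and> 4 * card T \<le> 2 ^ K \<and>
    (\<forall>F. finite F \<longrightarrow> F \<noteq> {} \<longrightarrow> F \<subseteq> carrier G \<longrightarrow> 8 * K * card F < card (F <#> T))"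
    by (intro expanding_power[of "insert \<one> S" \<epsilon>] \<epsilon>)
  then obtain T K where T: "finite T" "T \<subseteq> carrier G" "T \<noteq> {}" "4 * card T \<le> 2 ^ K"
    and expanding: "\<forall>F. finite F \<longrightarrow> F \<noteq> {} \<longrightarrow> F \<subseteq> carrier G \<longrightarrow> 8 * K * card F < card (F <#> T)"
    by (elim exE conjE)
  from expanding_imp_injective[OF G(1) T expanding]
  obtain m and \<alpha> :: "('a \<times> nat \<Rightarrow>\<^sub>0 int) \<Rightarrow> ('a \<times> nat \<Rightarrow>\<^sub>0 int)" where
    \<alpha>: "\<forall>x y. \<alpha> (x - y) = \<alpha> x - \<alpha> y"
    "\<forall>g\<in>carrier G. \<forall>x. Poly_Mapping.keys x \<subseteq> carrier G \<times> {..m} \<longrightarrow>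
      \<alpha> (G_set.translate (free_act G) g x) = G_set.translate (free_act G) g (\<alpha> x)"
    "\<forall>x. Poly_Mapping.keys x \<subseteq> carrier G \<times> {..m} \<longrightarrow> Poly_Mapping.keys (\<alpha> x) \<subseteq> carrier G \<times> {..<m}"
    "\<forall>x. Poly_Mapping.keys x \<subseteq> carrier G \<times> {..m} \<longrightarrow> \<alpha> x = 0 \<longrightarrow> x = 0"
    by (elim exE conjE)
  have "\<exists>x. Poly_Mapping.keys x \<subseteq> carrier G \<times> {..m} \<and> x \<noteq> 0 \<and> \<alpha> x = 0"
    by (rule strong_rank_condition[OF G]) (use \<alpha>(1-3) in \<open>auto simp del: split_paired_All\<close>)
  with \<alpha>(4) show False by blast
qed

section \<open>Groups with the Hall property\<close>

theorem theorem4p5: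
  fixes G :: "('a, 'b) monoid_scheme"
  assumes "group G"
    and "hall_property G"
  shows "right_noetherian (group_ring G :: ('a \<Rightarrow>\<^sub>0 rat) ring) \<and>
    left_noetherian (group_ring G :: ('a \<Rightarrow>\<^sub>0 rat) ring) \<and>
    amenable G \<and>
    (\<forall>H. subgroup H G \<longrightarrow> (\<exists>S. finite S \<and> S \<subseteq> H \<and> generate G S = H))"
  using right_noetherian_group_ring[OF assms] left_noetherian_group_ring[OF assms]
    hall_imp_amenable[OF assms] subgroups_finitely_generated[OF assms]
  by blast

end
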